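(* For every uniformly absorbing atomless MDP, the set $\mathcal M^{\mathbb F}=\{Q^\phi:\phi\in\mathbb F\}$ of occupancy measures of deterministic policies is path-connected in total variation, and therefore it is setwise path-connected.
   Context: A standard Borel space is a measurable space isomorphic to a Borel subset of a Polish space. An MDP consists of: a standard Borel state space $\bar{\mathbb X}$; a standard Borel action space $(\mathbb A,\mathcal A)$; nonempty sets $A(x)\in\mathcal A$ of available actions, $x\in\bar{\mathbb X}$, such that $\{(x,a):x\in\bar{\mathbb X},a\in A(x)\}$ is measurable; a transition probability $p$ from $\bar{\mathbb X}\times\mathbb A$ to $\bar{\mathbb X}$; a fixed initial probability distribution $\mu$ on $\bar{\mathbb X}$; a bounded measurable reward vector-function $r:\bar{\mathbb X}\times\mathbb A\to\mathbb R^N$, $N\ge1$. It is always assumed that there is at least one selector, i.e. a measurable map $\phi$ from the state space to $\mathbb A$ with $\phi(x)\in A(x)$ for all $x$. A policy $\pi$ is a sequence of transition probabilities $\pi_t$, $t=0,1,\ldots$, from the set of histories $h_t=(x_0,a_0,x_1,\ldots,x_t)$ to $\mathbb A$ with $\pi_t(A(x_t)|h_t)=1$; $\Pi$ is the set of all policies. A policy is nonrandomized if every $\pi_t(\cdot|h_t)$ is concentrated at one point, Markov if each $\pi_t(\cdot|h_t)$ depends only on $x_t$, and stationary if it is Markov and $\pi_t(\cdot|x)$ does not depend on $t$. $\mathbb M$ is the set of nonrandomized Markov policies and $\mathbb F$ is the set of deterministic (nonrandomized stationary) policies, identified with selectors. $P^\pi,E^\pi$ are the probability and expectation on trajectories determined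 by $\mu,\pi,p$. For a state $x$ let $T^{x}=\inf\{t=0,1,\ldots: x_t=x\}$. The MDP is absorbing if there is a state $\bar x\in\bar{\mathbb X}$ (fixed) such that: (i) $\mu(\{\bar x\})=0$; (ii) $A(\bar x)=\{\bar a\}$ for some $\bar a\in\mathbb A$, $p(\{\bar x\}|\bar x,\bar a)=1$, $r(\bar x,\bar a)=0$; (iii) there is a finite constant $L$ with $E^\pi T^{\bar x}\le L$ for all $\pi\in\Pi$. Put $\mathbb X=\bar{\mathbb X}\setminus\{\bar x\}$, with $\sigma$-field $\mathcal X$. An absorbing MDP is uniformly absorbing if $\lim_{n\to\infty}\sup_{\pi\in\mathbb M}E^\pi\sum_{t=n}^\infty I\{t<T^{\bar x}\}=0$. An absorbing MDP is atomless if $\mu(\{x\})=0$ and $p(\{y\}|x,a)=0$ for all $x,y\in\mathbb X$ and $a\in A(x)$. The occupancy measure of $\pi$ is the finite measure on $\mathbb X\times\mathbb A$ given by $Q^\pi(Y\times B)=\sum_{t=0}^\infty P^\pi\{x_t\in Y,a_t\in B\}$, $Y\in\mathcal X$, $B\in\mathcal A$. A subset $E$ of a topological space is path-connected if for any $e_0,e_1\in E$ there is a continuous $g:[0,1]\to E$ with $g(0)=e_0$, $g(1)=e_1$. A set of finite measures on a measurable space is path-connected in total variation if it is path-connected when the set of finite measures carries the total variation distance $d_{TV}(\eta_1,\eta_2)=\sup\{|\int f\,d\eta_1-\int f\,d\eta_2|: f \text{ measurable}, |f|\le1\}$. It is setwise path-connected if it is path-connected when the set of finite measures carries the topology of setwise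 convergence, i.e. the coarsest topology for which $\eta\mapsto\int f\,d\eta$ is continuous for every bounded measurable real function $f$. *)

theory Defs
  imports "HOL-Probability.Probability"
begin

section \<open>Standard Borel spaces\<close>

definition borel_of :: "'b topology \<Rightarrow> 'b measure" where
  "borel_of S = sigma (topspace S) {U. openin S U}"

text \<open>
  Only the measurable structure of \<open>M\<close> is relevant here, not the values of the measure.
  A Polish space has at most the cardinality of the continuum, so every Polish space is
  homeomorphic to one whose points are real numbers, carrying an arbitrary (in general
  non-Euclidean) topology \<open>S\<close>.  Quantifying over \<open>real topology\<close> is therefore no restriction.
\<close>

definition standard_borel :: "'b measure \<Rightarrow> bool" where
  "standard_borel M \<longleftrightarrow>
     (\<exists>(S :: real topology) B f g.
        completely_metrizable_space S \<and> separable_space S \<and> B \<in> sets (borel_of S) \<and>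
        f \<in> M \<rightarrow>\<^sub>M restrict_space (borel_of S) B \<and>
        g \<in> restrict_space (borel_of S) B \<rightarrow>\<^sub>M M \<and>
        (\<forall>x\<in>space M. g (f x) = x) \<and> (\<forall>y\<in>B. f (g y) = y))"


section \<open>Topologies on the set of finite measures\<close>

definition finite_measures :: "'b measure \<Rightarrow> 'b measure set" where
  "finite_measures N = {\<eta>. sets \<eta> = sets N \<and> finite_measure \<eta>}"

definition tv_test_functions :: "'b measure \<Rightarrow> ('b \<Rightarrow> real) set" where
  "tv_test_functions N = {f \<in> borel_measurable N. \<forall>z\<in>space N. \<bar>f z\<bar> \<le> 1}"

text \<open>The value \<open>0\<close> outside the finite measures is a totality convention.\<close>

definition tv_dist :: "'b measure \<Rightarrow> 'b measure \<Rightarrow> 'b measure \<Rightarrow> real" where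
  "tv_dist N \<eta>\<^sub>1 \<eta>\<^sub>2 =
     (if \<eta>\<^sub>1 \<in> finite_measures N \<and> \<eta>\<^sub>2 \<in> finite_measures N
      then SUP f\<in>tv_test_functions N. \<bar>(\<integral>z. f z \<partial>\<eta>\<^sub>1) - (\<integral>z. f z \<partial>\<eta>\<^sub>2)\<bar> else 0)"

definition tv_topology :: "'b measure \<Rightarrow> 'b measure topology" where
  "tv_topology N = Metric_space.mtopology (finite_measures N) (tv_dist N)"

definition setwise_topology :: "'b measure \<Rightarrow> 'b measure topology" where
  "setwise_topology N = topology_generated_by
     {{\<eta> \<in> finite_measures N. (\<integral>z. f z \<partial>\<eta>) \<in> U} | (f :: 'b \<Rightarrow> real) U.
        f \<in> borel_measurable N \<and> bounded (f ` space N) \<and> open U}"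

lemma integrable_tv_test_function:
  assumes "\<eta> \<in> finite_measures N" "f \<in> tv_test_functions N"
  shows "integrable \<eta> f" "\<bar>\<integral>z. f z \<partial>\<eta>\<bar> \<le> measure \<eta> (space \<eta>)"
proof -
  have s: "sets \<eta> = sets N" and fin: "finite_measure \<eta>"
    using assms by (auto simp: finite_measures_def)
  interpret finite_measure \<eta> by fact
  have b: "\<bar>f z\<bar> \<le> 1" if "z \<in> space \<eta>" for z
    using assms(2) that sets_eq_imp_space_eq[OF s] by (auto simp: tv_test_functions_def)
  have m: "f \<in> borel_measurable \<eta>"
    using assms(2) by (simp add: tv_test_functions_def measurable_cong_sets[OF s refl])
  show i: "integrable \<eta> f"
    by (rule integrable_const_bound[where B = 1]) (use b m in auto)
  have "\<bar>\<integral>z. f z \<partial>\<eta>\<bar> \<le> (\<integral>z. \<bar>f z\<bar> \<partial>\<eta>)"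
    by (rule integral_abs_bound)
  also have "\<dots> \<le> (\<integral>z. 1 \<partial>\<eta>)"
    by (rule integral_mono) (use i b in auto)
  finally show "\<bar>\<integral>z. f z \<partial>\<eta>\<bar> \<le> measure \<eta> (space \<eta>)"
    by simp
qed

lemma bdd_above_tv_dist:
  assumes "\<eta>\<^sub>1 \<in> finite_measures N" "\<eta>\<^sub>2 \<in> finite_measures N"
  shows "bdd_above ((\<lambda>f. \<bar>(\<integral>z. f z \<partial>\<eta>\<^sub>1) - (\<integral>z. f z \<partial>\<eta>\<^sub>2)\<bar>) ` tv_test_functions N)"
proof (rule bdd_aboveI2)
  fix f assume "f \<in> tv_test_functions N"
  then show "\<bar>(\<integral>z. f z \<partial>\<eta>\<^sub>1) - (\<integral>z. f z \<partial>\<eta>\<^sub>2)\<bar>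
      \<le> measure \<eta>\<^sub>1 (space \<eta>\<^sub>1) + measure \<eta>\<^sub>2 (space \<eta>\<^sub>2)"
    using integrable_tv_test_function(2)[OF assms(1), of f]
      integrable_tv_test_function(2)[OF assms(2), of f] by linarith
qed

lemma tv_dist_upper:
  assumes "\<eta>\<^sub>1 \<in> finite_measures N" "\<eta>\<^sub>2 \<in> finite_measures N" "f \<in> tv_test_functions N"
  shows "\<bar>(\<integral>z. f z \<partial>\<eta>\<^sub>1) - (\<integral>z. f z \<partial>\<eta>\<^sub>2)\<bar> \<le> tv_dist N \<eta>\<^sub>1 \<eta>\<^sub>2"
  using assms(1,2) cSUP_upper[OF assms(3) bdd_above_tv_dist[OF assms(1,2)]]
  by (simp add: tv_dist_def)

lemma tv_dist_least:
  assumes "\<eta>\<^sub>1 \<in> finite_measures N" "\<eta>\<^sub>2 \<in> finite_measures N"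
    and "\<And>f. f \<in> tv_test_functions N \<Longrightarrow> \<bar>(\<integral>z. f z \<partial>\<eta>\<^sub>1) - (\<integral>z. f z \<partial>\<eta>\<^sub>2)\<bar> \<le> c"
  shows "tv_dist N \<eta>\<^sub>1 \<eta>\<^sub>2 \<le> c"
proof -
  have "(\<lambda>_. 0) \<in> tv_test_functions N"
    by (simp add: tv_test_functions_def)
  then have "tv_test_functions N \<noteq> {}" by blast
  then show ?thesis
    using assms by (auto simp: tv_dist_def intro!: cSUP_least)
qed

lemma Metric_space_tv_dist: "Metric_space (finite_measures N) (tv_dist N)"
proof
  have zero: "(\<lambda>_. 0) \<in> tv_test_functions N"
    by (simp add: tv_test_functions_def)
  show "0 \<le> tv_dist N x y" for x y
  proof (cases "x \<in> finite_measures N \<and> y \<in> finite_measures N")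
    case True
    then show ?thesis using tv_dist_upper[of x N y, OF _ _ zero] by simp
  qed (auto simp: tv_dist_def)
  show "tv_dist N x y = tv_dist N y x" for x y
    by (auto simp: tv_dist_def abs_minus_commute)
  show "tv_dist N x y = 0 \<longleftrightarrow> x = y"
    if x: "x \<in> finite_measures N" and y: "y \<in> finite_measures N" for x y
  proof
    assume d: "tv_dist N x y = 0"
    have sx: "sets x = sets N" and sy: "sets y = sets N"
      and fx: "finite_measure x" and fy: "finite_measure y"
      using x y by (auto simp: finite_measures_def)
    show "x = y"
    proof (rule measure_eqI)
      show "sets x = sets y" using sx sy by simp
      fix A assume A: "A \<in> sets x"
      have "indicator A \<in> tv_test_functions N"
        using A sx by (auto simp: tv_test_functions_def indicator_def)
      from tv_dist_upper[OF x y this] d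
      have "measure x (A \<inter> space x) = measure y (A \<inter> space y)" by simp
      then have "measure x A = measure y A"
        using sets.sets_into_space[of A x] sets.sets_into_space[of A y] A sx sy
        by (simp add: Int_absorb2)
      then show "emeasure x A = emeasure y A"
        using fx fy by (simp add: finite_measure.emeasure_eq_measure)
    qed
  next
    assume "x = y"
    then show "tv_dist N x y = 0"
      using x zero by (auto simp: tv_dist_def intro!: cSUP_const)
  qed
  show "tv_dist N x z \<le> tv_dist N x y + tv_dist N y z"
    if "x \<in> finite_measures N" "y \<in> finite_measures N" "z \<in> finite_measures N" for x y z
  proof (rule tv_dist_least)
    fix f assume "f \<in> tv_test_functions N"
    then show "\<bar>(\<integral>w. f w \<partial>x) - (\<integral>w. f w \<partial>z)\<bar> \<le> tv_dist N x y + tv_dist N y z"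
      using tv_dist_upper[of x N y f] tv_dist_upper[of y N z f] that by linarith
  qed (use that in auto)
qed

lemma topspace_tv_topology: "topspace (tv_topology N) = finite_measures N"
proof -
  interpret Metric_space "finite_measures N" "tv_dist N"
    by (rule Metric_space_tv_dist)
  show ?thesis by (simp add: tv_topology_def)
qed

lemma topspace_setwise_topology: "topspace (setwise_topology N) = finite_measures N"
proof -
  have "finite_measures N \<in> {{\<eta> \<in> finite_measures N. (\<integral>z. f z \<partial>\<eta>) \<in> U} | (f :: 'a \<Rightarrow> real) U.
        f \<in> borel_measurable N \<and> bounded (f ` space N) \<and> open U}"
    by (rule CollectI, rule exI[of _ "\<lambda>_. 0"], rule exI[of _ UNIV]) (auto simp: image_constant_conv)
  then show ?thesis
    unfolding setwise_topology_def topology_generated_by_topspace by blast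
qed


section \<open>Markov decision processes\<close>

text \<open>
  \<open>SX\<close> and \<open>SA\<close> carry the measurable structure of the state and the action space; \<open>Act x\<close>
  is the set of actions available at \<open>x\<close>.
\<close>

locale mdp =
  fixes SX :: "'x measure" and SA :: "'a measure"
    and Act :: "'x \<Rightarrow> 'a set"
    and p :: "'x \<times> 'a \<Rightarrow> 'x measure"
    and mu :: "'x measure"
    and r :: "'x \<times> 'a \<Rightarrow> real ^ 'n"
  assumes standard_borel_SX: "standard_borel SX"
    and standard_borel_SA: "standard_borel SA"
    and Act_nonempty: "\<And>x. x \<in> space SX \<Longrightarrow> Act x \<noteq> {}"
    and Act_sets: "\<And>x. x \<in> space SX \<Longrightarrow> Act x \<in> sets SA"
    and graph_sets: "{(x, a). x \<in> space SX \<and> a \<in> Act x} \<in> sets (SX \<Otimes>\<^sub>M SA)"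
    and transition: "p \<in> SX \<Otimes>\<^sub>M SA \<rightarrow>\<^sub>M prob_algebra SX"
    and initial: "mu \<in> space (prob_algebra SX)"
    and reward_measurable: "r \<in> borel_measurable (SX \<Otimes>\<^sub>M SA)"
    and reward_bounded: "bounded (r ` space (SX \<Otimes>\<^sub>M SA))"
    and ex_selector: "\<exists>\<phi> \<in> SX \<rightarrow>\<^sub>M SA. \<forall>x\<in>space SX. \<phi> x \<in> Act x"
begin

text \<open>
  A trajectory is \<open>\<omega> :: nat \<Rightarrow> 'x \<times> 'a\<close> with \<open>\<omega> t = (x\<^sub>t, a\<^sub>t)\<close>.  The history
  \<open>h\<^sub>t = (x\<^sub>0, a\<^sub>0, \<dots>, x\<^sub>t\<^sub>-\<^sub>1, a\<^sub>t\<^sub>-\<^sub>1, x\<^sub>t)\<close> is the pair of the trajectory up to time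
  \<open>t - 1\<close> and the current state.
\<close>

definition history :: "nat \<Rightarrow> ((nat \<Rightarrow> 'x \<times> 'a) \<times> 'x) measure" where
  "history t = PiM {0..<t} (\<lambda>_. SX \<Otimes>\<^sub>M SA) \<Otimes>\<^sub>M SX"

definition policy :: "(nat \<Rightarrow> (nat \<Rightarrow> 'x \<times> 'a) \<times> 'x \<Rightarrow> 'a measure) \<Rightarrow> bool" where
  "policy \<pi> \<longleftrightarrow> (\<forall>t. \<pi> t \<in> history t \<rightarrow>\<^sub>M prob_algebra SA \<and>
                    (\<forall>h\<in>space (history t). emeasure (\<pi> t h) (Act (snd h)) = 1))"

definition nonrandomized :: "(nat \<Rightarrow> (nat \<Rightarrow> 'x \<times> 'a) \<times> 'x \<Rightarrow> 'a measure) \<Rightarrow> bool" where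
  "nonrandomized \<pi> \<longleftrightarrow>
     (\<forall>t. \<forall>h\<in>space (history t). \<exists>a\<in>space SA. emeasure (\<pi> t h) {a} = 1)"

definition markov :: "(nat \<Rightarrow> (nat \<Rightarrow> 'x \<times> 'a) \<times> 'x \<Rightarrow> 'a measure) \<Rightarrow> bool" where
  "markov \<pi> \<longleftrightarrow>
     (\<forall>t. \<exists>\<kappa>. \<forall>h\<in>space (history t). \<pi> t h = \<kappa> (snd h))"

definition stationary :: "(nat \<Rightarrow> (nat \<Rightarrow> 'x \<times> 'a) \<times> 'x \<Rightarrow> 'a measure) \<Rightarrow> bool" where
  "stationary \<pi> \<longleftrightarrow>
     (\<exists>\<kappa>. \<forall>t. \<forall>h\<in>space (history t). \<pi> t h = \<kappa> (snd h))"

definition nonrandomized_markov_policies :: "(nat \<Rightarrow> (nat \<Rightarrow> 'x \<times> 'a) \<times> 'x \<Rightarrow> 'a measure) set" where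
  "nonrandomized_markov_policies = {\<pi>. policy \<pi> \<and> nonrandomized \<pi> \<and> markov \<pi>}"

definition deterministic_policies :: "(nat \<Rightarrow> (nat \<Rightarrow> 'x \<times> 'a) \<times> 'x \<Rightarrow> 'a measure) set" where
  "deterministic_policies = {\<pi>. policy \<pi> \<and> nonrandomized \<pi> \<and> stationary \<pi>}"

text \<open>
  \<open>step \<pi> t \<omega>\<close> is the conditional distribution of \<open>(x\<^sub>t, a\<^sub>t)\<close> given the trajectory \<open>\<omega>\<close> up to
  time \<open>t - 1\<close>; \<open>traj \<pi>\<close> is the resulting Ionescu Tulcea measure \<open>P\<^sup>\<pi>\<close> on trajectories.
\<close>

definition step ::
  "(nat \<Rightarrow> (nat \<Rightarrow> 'x \<times> 'a) \<times> 'x \<Rightarrow> 'a measure) \<Rightarrow> nat \<Rightarrow> (nat \<Rightarrow> 'x \<times> 'a) \<Rightarrow> ('x \<times> 'a) measure" where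
  "step \<pi> t \<omega> = (if t = 0 then mu else p (\<omega> (t - 1))) \<bind>
     (\<lambda>x. \<pi> t (\<omega>, x) \<bind> (\<lambda>a. return (SX \<Otimes>\<^sub>M SA) (x, a)))"

definition traj :: "(nat \<Rightarrow> (nat \<Rightarrow> 'x \<times> 'a) \<times> 'x \<Rightarrow> 'a measure) \<Rightarrow> (nat \<Rightarrow> 'x \<times> 'a) measure" where
  "traj \<pi> = projective_family.lim UNIV
     (Ionescu_Tulcea.CI (step \<pi>) (\<lambda>_. SX \<Otimes>\<^sub>M SA)) (\<lambda>_. SX \<Otimes>\<^sub>M SA)"

lemma Ionescu_Tulcea_step:
  assumes "policy \<pi>"
  shows "Ionescu_Tulcea (step \<pi>) (\<lambda>_. SX \<Otimes>\<^sub>M SA)"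
proof -
  have step: "step \<pi> t \<in> PiM {0..<t} (\<lambda>_. SX \<Otimes>\<^sub>M SA) \<rightarrow>\<^sub>M prob_algebra (SX \<Otimes>\<^sub>M SA)" for t
  proof -
    note [measurable] = transition
    have [measurable]: "\<pi> t \<in> PiM {0..<t} (\<lambda>_. SX \<Otimes>\<^sub>M SA) \<Otimes>\<^sub>M SX \<rightarrow>\<^sub>M prob_algebra SA"
      using assms by (simp add: policy_def history_def)
    have "(\<lambda>\<omega>. if t = 0 then mu else p (\<omega> (t - 1)))
        \<in> PiM {0..<t} (\<lambda>_. SX \<Otimes>\<^sub>M SA) \<rightarrow>\<^sub>M prob_algebra SX"
    proof (cases "t = 0")
      case True then show ?thesis using initial by simp
    next
      case False
      then have [measurable]: "(\<lambda>\<omega>. \<omega> (t - 1)) \<in> PiM {0..<t} (\<lambda>_. SX \<Otimes>\<^sub>M SA) \<rightarrow>\<^sub>M SX \<Otimes>\<^sub>M SA"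
        by (intro measurable_component_singleton) auto
      show ?thesis using False by simp
    qed
    then show ?thesis
      unfolding step_def
      by (rule measurable_bind_prob_space2) measurable
  qed
  show ?thesis
  proof (rule Ionescu_Tulcea.intro)
    show "step \<pi> i \<in> PiM {0..<i} (\<lambda>_. SX \<Otimes>\<^sub>M SA) \<rightarrow>\<^sub>M subprob_algebra (SX \<Otimes>\<^sub>M SA)" for i
      by (rule measurable_prob_algebraD[OF step])
    show "prob_space (step \<pi> i \<omega>)" if "\<omega> \<in> space (PiM {0..<i} (\<lambda>_. SX \<Otimes>\<^sub>M SA))" for i \<omega>
      using measurable_space[OF step that] by (simp add: space_prob_algebra)
  qed
qed

definition hitting_time :: "'x \<Rightarrow> (nat \<Rightarrow> 'x \<times> 'a) \<Rightarrow> enat" where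
  "hitting_time y \<omega> = Inf {enat t | t. fst (\<omega> t) = y}"

end


section \<open>Absorbing MDPs and occupancy measures\<close>

locale absorbing_mdp = mdp SX SA Act p mu r
  for SX :: "'x measure" and SA :: "'a measure" and Act p mu and r :: "'x \<times> 'a \<Rightarrow> real ^ 'n" +
  fixes xbar :: 'x
  assumes xbar_space: "xbar \<in> space SX"
    and initial_xbar: "emeasure mu {xbar} = 0"
    and absorbing_xbar:
      "\<exists>abar. Act xbar = {abar} \<and> emeasure (p (xbar, abar)) {xbar} = 1 \<and> r (xbar, abar) = 0"
    and hitting_time_bound:
      "\<exists>L::real. \<forall>\<pi>. policy \<pi> \<longrightarrow>
         (\<integral>\<^sup>+\<omega>. ennreal_of_enat (hitting_time xbar \<omega>) \<partial>traj \<pi>) \<le> ennreal L"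
begin

definition live :: "'x measure" where
  "live = restrict_space SX (space SX - {xbar})"

text \<open>
  The value is given on every measurable \<open>Z\<close>; the rectangles \<open>Y \<times> B\<close> generate the
  product \<open>\<sigma>\<close>-algebra, see \<open>emeasure_occupancy_Times\<close>.
\<close>

definition occupancy :: "(nat \<Rightarrow> (nat \<Rightarrow> 'x \<times> 'a) \<times> 'x \<Rightarrow> 'a measure) \<Rightarrow> ('x \<times> 'a) measure" where
  "occupancy \<pi> = measure_of (space (live \<Otimes>\<^sub>M SA)) (sets (live \<Otimes>\<^sub>M SA))
     (\<lambda>Z. \<Sum>t. emeasure (traj \<pi>) {\<omega> \<in> space (traj \<pi>). \<omega> t \<in> Z})"

definition det_occupancies :: "('x \<times> 'a) measure set" where
  "det_occupancies = occupancy ` deterministic_policies"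

lemma emeasure_occupancy:
  assumes "policy \<pi>" and Z: "Z \<in> sets (live \<Otimes>\<^sub>M SA)"
  shows "emeasure (occupancy \<pi>) Z = (\<Sum>t. emeasure (traj \<pi>) {\<omega> \<in> space (traj \<pi>). \<omega> t \<in> Z})"
proof -
  interpret Ionescu_Tulcea "step \<pi>" "\<lambda>_. SX \<Otimes>\<^sub>M SA"
    by (rule Ionescu_Tulcea_step[OF assms(1)])
  have sets_traj: "sets (traj \<pi>) = sets (PiM UNIV (\<lambda>_. SX \<Otimes>\<^sub>M SA))"
    unfolding traj_def by simp
  have coord: "(\<lambda>\<omega>. \<omega> t) \<in> traj \<pi> \<rightarrow>\<^sub>M SX \<Otimes>\<^sub>M SA" for t
    unfolding measurable_cong_sets[OF sets_traj refl] by measurable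
  have "{xbar} \<in> sets SX"
  proof -
    obtain abar where "emeasure (p (xbar, abar)) {xbar} = 1" "abar \<in> Act xbar"
      using absorbing_xbar by auto
    moreover from this have "abar \<in> space SA"
      using sets.sets_into_space[OF Act_sets[OF xbar_space]] by auto
    ultimately show ?thesis
      using measurable_space[OF transition, of "(xbar, abar)"] xbar_space emeasure_notin_sets
      by (fastforce simp: space_pair_measure space_prob_algebra)
  qed
  then have X: "space SX - {xbar} \<in> sets SX" by auto
  have sub: "W \<in> sets (SX \<Otimes>\<^sub>M SA)" if "W \<in> sets (live \<Otimes>\<^sub>M SA)" for W
  proof -
    have sp: "space live = space SX - {xbar}"
      unfolding live_def by (auto simp: space_restrict_space)
    have rect: "Y \<times> B \<in> sets (SX \<Otimes>\<^sub>M SA)" if "Y \<in> sets live" "B \<in> sets SA" for Y B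
      using that X by (auto simp: live_def sets_restrict_space)
    have "W \<in> sigma_sets (space live \<times> space SA) {a \<times> b |a b. a \<in> sets live \<and> b \<in> sets SA}"
      using that by (simp add: sets_pair_measure)
    then show ?thesis
    proof induction
      case (Compl W)
      have "space live \<times> space SA \<in> sets (SX \<Otimes>\<^sub>M SA)" by (rule rect) auto
      then show ?case using Compl.IH by auto
    qed (use rect in auto)
  qed
  have ev: "{\<omega> \<in> space (traj \<pi>). \<omega> t \<in> W} \<in> sets (traj \<pi>)" if "W \<in> sets (live \<Otimes>\<^sub>M SA)" for t W
    using measurable_sets[OF coord[of t] sub[OF that]]
    by (simp add: vimage_def Int_def conj_commute)
  show ?thesis
    unfolding occupancy_def
  proof (rule emeasure_measure_of_sigma[OF _ _ _ Z])
    show "sigma_algebra (space (live \<Otimes>\<^sub>M SA)) (sets (live \<Otimes>\<^sub>M SA))"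
      by (rule sets.sigma_algebra_axioms)
    show "positive (sets (live \<Otimes>\<^sub>M SA)) (\<lambda>Z. \<Sum>t. emeasure (traj \<pi>) {\<omega> \<in> space (traj \<pi>). \<omega> t \<in> Z})"
      by (simp add: positive_def)
    show "countably_additive (sets (live \<Otimes>\<^sub>M SA)) (\<lambda>Z. \<Sum>t. emeasure (traj \<pi>) {\<omega> \<in> space (traj \<pi>). \<omega> t \<in> Z})"
    proof (rule countably_additiveI)
      fix W :: "nat \<Rightarrow> ('x \<times> 'a) set"
      assume W: "range W \<subseteq> sets (live \<Otimes>\<^sub>M SA)" and dis: "disjoint_family W"
      have "(\<Sum>i. emeasure (traj \<pi>) {\<omega> \<in> space (traj \<pi>). \<omega> t \<in> W i})
          = emeasure (traj \<pi>) {\<omega> \<in> space (traj \<pi>). \<omega> t \<in> (\<Union>i. W i)}" for t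
      proof -
        have "(\<Sum>i. emeasure (traj \<pi>) {\<omega> \<in> space (traj \<pi>). \<omega> t \<in> W i})
            = emeasure (traj \<pi>) (\<Union>i. {\<omega> \<in> space (traj \<pi>). \<omega> t \<in> W i})"
        proof (rule suminf_emeasure)
          show "range (\<lambda>i. {\<omega> \<in> space (traj \<pi>). \<omega> t \<in> W i}) \<subseteq> sets (traj \<pi>)"
            using ev W by auto
          show "disjoint_family (\<lambda>i. {\<omega> \<in> space (traj \<pi>). \<omega> t \<in> W i})"
            using dis by (fastforce simp: disjoint_family_on_def)
        qed
        also have "(\<Union>i. {\<omega> \<in> space (traj \<pi>). \<omega> t \<in> W i})
            = {\<omega> \<in> space (traj \<pi>). \<omega> t \<in> (\<Union>i. W i)}" by auto
        finally show ?thesis .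
      qed
      then show "(\<Sum>i. \<Sum>t. emeasure (traj \<pi>) {\<omega> \<in> space (traj \<pi>). \<omega> t \<in> W i})
          = (\<Sum>t. emeasure (traj \<pi>) {\<omega> \<in> space (traj \<pi>). \<omega> t \<in> (\<Union>i. W i)})"
        using nn_integral_suminf[of "\<lambda>i t. emeasure (traj \<pi>) {\<omega> \<in> space (traj \<pi>). \<omega> t \<in> W i}"
            "count_space UNIV"]
        by (simp add: nn_integral_count_space_nat)
    qed
  qed
qed

corollary emeasure_occupancy_Times:
  assumes "policy \<pi>" "Y \<in> sets live" "B \<in> sets SA"
  shows "emeasure (occupancy \<pi>) (Y \<times> B) =
    (\<Sum>t. emeasure (traj \<pi>) {\<omega> \<in> space (traj \<pi>). fst (\<omega> t) \<in> Y \<and> snd (\<omega> t) \<in> B})"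
  using emeasure_occupancy[OF assms(1), of "Y \<times> B"] assms by (simp add: mem_Times_iff)

end

locale uniformly_absorbing_mdp = absorbing_mdp SX SA Act p mu r xbar
  for SX :: "'x measure" and SA :: "'a measure" and Act p mu
    and r :: "'x \<times> 'a \<Rightarrow> real ^ 'n" and xbar +
  assumes uniformly_absorbing:
    "(\<lambda>n. SUP \<pi>\<in>nonrandomized_markov_policies.
        \<integral>\<^sup>+\<omega>. (\<Sum>t. if enat (n + t) < hitting_time xbar \<omega> then 1 else 0) \<partial>traj \<pi>)
      \<longlonglongrightarrow> (0 :: ennreal)"

locale atomless_mdp = absorbing_mdp SX SA Act p mu r xbar
  for SX :: "'x measure" and SA :: "'a measure" and Act p mu
    and r :: "'x \<times> 'a \<Rightarrow> real ^ 'n" and xbar +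
  assumes atomless_initial: "\<And>x. x \<in> space SX - {xbar} \<Longrightarrow> emeasure mu {x} = 0"
    and atomless_transition:
      "\<And>x y a. x \<in> space SX - {xbar} \<Longrightarrow> y \<in> space SX - {xbar} \<Longrightarrow> a \<in> Act x \<Longrightarrow>
         emeasure (p (x, a)) {y} = 0"

end

theory Submission
  imports Defs
begin

text \<open>
  Two deterministic policies, given by kernels \<open>\<kappa>\<^sub>0\<close> and \<open>\<kappa>\<^sub>1\<close> whose values are point masses,
  are joined by a path that switches from one to the other state by state.  Since the state
  space is standard Borel, there is a measurable injection \<open>g\<close> of it into \<open>(0, 1)\<close>
  (\<open>standard_borel_real_injection\<close>).  For \<open>s \<in> [0, 1]\<close> let \<open>\<kappa>\<^sub>s\<close> be \<open>\<kappa>\<^sub>1\<close> where \<open>g \<le> s\<close> and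
  \<open>\<kappa>\<^sub>0\<close> elsewhere.  Every \<open>\<kappa>\<^sub>s\<close> is again deterministic, so the whole path stays among the
  deterministic policies, and it runs from \<open>\<kappa>\<^sub>0\<close> to \<open>\<kappa>\<^sub>1\<close>.

  The occupancy measure depends continuously on \<open>s\<close> for two reasons.

  Over a finite horizon, atomlessness suffices.  Kernels \<open>\<kappa>\<^sub>s\<close> and \<open>\<kappa>\<^sub>u\<close> differ only on states
  whose \<open>g\<close>-value lies between \<open>s\<close> and \<open>u\<close>; the absorbing state is never among them, as only
  one action is available there.  Propagating the difference step by step, a Markov kernel
  does not increase total variation, and replacing a kernel on a set \<open>D\<close> costs at most twice
  the mass of \<open>D\<close>.  Hence the joint laws of state and action at time \<open>t\<close> are within
  \<open>2 (m\<^sub>0 D + \<dots> + m\<^sub>t D)\<close> of each other, where \<open>m\<^sub>i\<close> is the law of the state at time \<open>i\<close>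
  under \<open>\<kappa>\<^sub>s\<close> alone (\<open>tv_dist_law_le\<close>).  As \<open>u\<close> tends to \<open>s\<close>, the set \<open>D\<close> shrinks into
  \<open>{g = s}\<close>, which has at most one point, and \<open>m\<^sub>i\<close> has no atoms besides the absorbing state
  (\<open>state_law_level_window\<close>).

  Beyond the horizon, uniform absorption bounds the remaining mass uniformly over all
  deterministic policies (\<open>uniform_law_tail\<close>).  To use it, the sum of the probabilities of
  being alive at late times has to be compared with the expected remaining time before the
  first visit to the absorbing state; the comparison holds because almost surely that state
  is never left (\<open>AE_absorbed\<close>).  The two estimates are put together for countable sums of
  measures in \<open>tv_dist_countable_sum_le\<close>.

  Setwise path-connectedness follows because the total variation topology is finer than the
  topology of setwise convergence (\<open>continuous_map_tv_setwise\<close>).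
\<close>

section \<open>Total variation distance and Markov kernels\<close>

lemma tv_dist_nonneg: "0 \<le> tv_dist N x y"
  using Metric_space.nonneg[OF Metric_space_tv_dist] .

lemma prob_algebra_finite_measures: "x \<in> space (prob_algebra N) \<Longrightarrow> x \<in> finite_measures N"
  by (auto simp: finite_measures_def space_prob_algebra prob_space.finite_measure)

lemma integral_bind_test_function:
  assumes "\<mu> \<in> space (prob_algebra M)" "k \<in> M \<rightarrow>\<^sub>M prob_algebra N" "f \<in> tv_test_functions N"
  shows "(\<integral>z. f z \<partial>(\<mu> \<bind> k)) = (\<integral>x. \<integral>z. f z \<partial>k x \<partial>\<mu>)"
    and "(\<lambda>x. \<integral>z. f z \<partial>k x) \<in> tv_test_functions M"
proof -
  have sets: "sets \<mu> = sets M" and "prob_space \<mu>"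
    using assms(1) by (auto simp: space_prob_algebra)
  then have fin: "finite_measure \<mu>" by (simp add: prob_space.finite_measure)
  have kx: "k x \<in> space (prob_algebra N)" if "x \<in> space M" for x
    using measurable_space[OF assms(2) that] .
  have f[measurable]: "f \<in> borel_measurable N" and b: "\<And>z. z \<in> space N \<Longrightarrow> \<bar>f z\<bar> \<le> 1"
    using assms(3) by (auto simp: tv_test_functions_def)
  have k[measurable]: "k \<in> M \<rightarrow>\<^sub>M subprob_algebra N"
    by (rule measurable_prob_algebraD[OF assms(2)])
  show "(\<integral>z. f z \<partial>(\<mu> \<bind> k)) = (\<integral>x. \<integral>z. f z \<partial>k x \<partial>\<mu>)"
  proof (rule integral_bind[OF f b _ fin, where B' = 1])
    show "k \<in> \<mu> \<rightarrow>\<^sub>M subprob_algebra N"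
      by (simp add: measurable_cong_sets[OF sets refl])
    show "AE x in \<mu>. emeasure (k x) (space (k x)) \<le> ennreal 1"
      using kx sets_eq_imp_space_eq[OF sets]
      by (intro AE_I2) (auto simp: space_prob_algebra prob_space.emeasure_space_1)
  qed auto
  show "(\<lambda>x. \<integral>z. f z \<partial>k x) \<in> tv_test_functions M"
  proof -
    have "\<bar>\<integral>z. f z \<partial>k x\<bar> \<le> 1" if "x \<in> space M" for x
    proof -
      have "\<bar>\<integral>z. f z \<partial>k x\<bar> \<le> measure (k x) (space (k x))"
        by (rule integrable_tv_test_function(2)[OF prob_algebra_finite_measures[OF kx[OF that]] assms(3)])
      also have "\<dots> = 1"
        using kx[OF that] by (auto simp: space_prob_algebra prob_space.prob_space)
      finally show ?thesis .
    qed
    moreover have "(\<lambda>x. \<integral>z. f z \<partial>k x) \<in> borel_measurable M"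
      by measurable
    ultimately show ?thesis by (auto simp: tv_test_functions_def)
  qed
qed

lemma bind_in_prob_algebra:
  assumes "\<mu> \<in> space (prob_algebra M)" "k \<in> M \<rightarrow>\<^sub>M prob_algebra N"
  shows "\<mu> \<bind> k \<in> space (prob_algebra N)"
proof -
  have "(\<lambda>_::unit. \<mu> \<bind> k) \<in> count_space UNIV \<rightarrow>\<^sub>M prob_algebra N"
    by (rule measurable_bind_prob_space[OF _ assms(2)]) (use assms(1) in simp)
  then show ?thesis by (auto dest: measurable_space)
qed

text \<open>
  Integrating a test function against a Markov kernel gives a test function again, so passing
  two measures through the same kernel cannot increase their distance.
\<close>

lemma tv_dist_bind_le:
  assumes "\<mu> \<in> space (prob_algebra M)" "\<nu> \<in> space (prob_algebra M)" "k \<in> M \<rightarrow>\<^sub>M prob_algebra N"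
  shows "tv_dist N (\<mu> \<bind> k) (\<nu> \<bind> k) \<le> tv_dist M \<mu> \<nu>"
proof (rule tv_dist_least)
  fix f assume f: "f \<in> tv_test_functions N"
  show "\<bar>(\<integral>z. f z \<partial>(\<mu> \<bind> k)) - (\<integral>z. f z \<partial>(\<nu> \<bind> k))\<bar> \<le> tv_dist M \<mu> \<nu>"
    using assms tv_dist_upper[OF _ _ integral_bind_test_function(2)[OF assms(1,3) f], of \<mu> \<nu>]
    by (simp add: integral_bind_test_function(1)[OF _ _ f] prob_algebra_finite_measures)
qed (use assms in \<open>auto intro!: prob_algebra_finite_measures bind_in_prob_algebra\<close>)

text \<open>
  Off \<open>D\<close> the two kernels integrate every test function to the same value, and on \<open>D\<close> the
  two integrals lie in \<open>[-1, 1]\<close>, which is where the factor 2 comes from.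
\<close>

lemma tv_dist_bind_kernels_le:
  assumes mu: "\<mu> \<in> space (prob_algebra M)"
    and k: "k \<in> M \<rightarrow>\<^sub>M prob_algebra N" and l: "l \<in> M \<rightarrow>\<^sub>M prob_algebra N"
    and D: "D \<in> sets M" and eq: "\<And>x. x \<in> space M - D \<Longrightarrow> k x = l x"
  shows "tv_dist N (\<mu> \<bind> k) (\<mu> \<bind> l) \<le> 2 * measure \<mu> D"
proof (rule tv_dist_least)
  fix f assume f: "f \<in> tv_test_functions N"
  have sets: "sets \<mu> = sets M" and "prob_space \<mu>"
    using mu by (auto simp: space_prob_algebra)
  then interpret prob_space \<mu> by simp
  let ?F = "\<lambda>k x. \<integral>z. f z \<partial>k x"
  have tk: "?F k \<in> tv_test_functions M" and tl: "?F l \<in> tv_test_functions M"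
    using integral_bind_test_function(2)[OF mu _ f] k l by auto
  have ik: "integrable \<mu> (?F k)" and il: "integrable \<mu> (?F l)"
    using integrable_tv_test_function(1)[OF prob_algebra_finite_measures[OF mu]] tk tl by auto
  have "\<bar>(\<integral>z. f z \<partial>(\<mu> \<bind> k)) - (\<integral>z. f z \<partial>(\<mu> \<bind> l))\<bar> = \<bar>\<integral>x. ?F k x - ?F l x \<partial>\<mu>\<bar>"
    using mu k l by (simp add: integral_bind_test_function(1)[OF _ _ f] ik il)
  also have "\<dots> \<le> (\<integral>x. \<bar>?F k x - ?F l x\<bar> \<partial>\<mu>)"
    by (rule integral_abs_bound)
  also have "\<dots> \<le> (\<integral>x. 2 * indicator D x \<partial>\<mu>)"
  proof (rule integral_mono)
    show "integrable \<mu> (\<lambda>x. \<bar>?F k x - ?F l x\<bar>)" using ik il by simp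
    show "integrable \<mu> (\<lambda>x. 2 * indicator D x :: real)"
      using D sets by (simp add: emeasure_eq_measure)
    fix x assume "x \<in> space \<mu>"
    then have x: "x \<in> space M" by (simp add: sets_eq_imp_space_eq[OF sets])
    then have "\<bar>?F k x\<bar> \<le> 1" "\<bar>?F l x\<bar> \<le> 1"
      using tk tl by (auto simp: tv_test_functions_def)
    then show "\<bar>?F k x - ?F l x\<bar> \<le> 2 * indicator D x"
      using eq[of x] x by (cases "x \<in> D") auto
  qed
  also have "\<dots> = 2 * measure \<mu> D"
    using D sets sets.sets_into_space[of D \<mu>] by (simp add: Int_absorb2)
  finally show "\<bar>(\<integral>z. f z \<partial>(\<mu> \<bind> k)) - (\<integral>z. f z \<partial>(\<mu> \<bind> l))\<bar> \<le> 2 * measure \<mu> D" .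
qed (use assms in \<open>auto intro!: prob_algebra_finite_measures bind_in_prob_algebra\<close>)

text \<open>
  A test function on \<open>W\<close>, extended by 0, is a test function on the whole space.
\<close>

lemma tv_dist_restrict_space_le:
  assumes fin: "\<mu> \<in> finite_measures N" "\<nu> \<in> finite_measures N" and W: "W \<in> sets N"
  shows "tv_dist (restrict_space N W) (restrict_space \<mu> W) (restrict_space \<nu> W) \<le> tv_dist N \<mu> \<nu>"
proof (rule tv_dist_least)
  have sets: "sets \<mu> = sets N" "sets \<nu> = sets N" and "finite_measure \<mu>" "finite_measure \<nu>"
    using fin by (auto simp: finite_measures_def)
  then show "restrict_space \<mu> W \<in> finite_measures (restrict_space N W)"
      "restrict_space \<nu> W \<in> finite_measures (restrict_space N W)"
    using W by (auto simp: finite_measures_def cong: sets_restrict_space_cong intro!: finite_measure_restrict_space)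
  fix f assume f: "f \<in> tv_test_functions (restrict_space N W)"
  have g: "(\<lambda>z. indicator W z *\<^sub>R f z) \<in> tv_test_functions N"
    using f W by (auto simp: tv_test_functions_def borel_measurable_restrict_space_iff indicator_def
        mult.commute[of "f _"])
  show "\<bar>(\<integral>z. f z \<partial>restrict_space \<mu> W) - (\<integral>z. f z \<partial>restrict_space \<nu> W)\<bar> \<le> tv_dist N \<mu> \<nu>"
    using tv_dist_upper[OF fin g] W sets by (simp add: integral_restrict_space)
qed

lemma nn_integral_bind_prob_algebra:
  assumes "\<mu> \<in> space (prob_algebra M)" "k \<in> M \<rightarrow>\<^sub>M prob_algebra N" "f \<in> borel_measurable N"
  shows "(\<integral>\<^sup>+z. f z \<partial>(\<mu> \<bind> k)) = (\<integral>\<^sup>+x. \<integral>\<^sup>+z. f z \<partial>k x \<partial>\<mu>)"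
proof (rule nn_integral_bind[OF assms(3)])
  show "k \<in> \<mu> \<rightarrow>\<^sub>M subprob_algebra N"
    using assms(1) measurable_prob_algebraD[OF assms(2)]
    by (simp add: space_prob_algebra cong: measurable_cong_sets)
qed

section \<open>Countable sums of finite measures\<close>

definition is_countable_sum :: "'b measure \<Rightarrow> (nat \<Rightarrow> 'b measure) \<Rightarrow> 'b measure \<Rightarrow> bool" where
  "is_countable_sum N M Q \<longleftrightarrow> sets Q = sets N \<and> (\<forall>t. M t \<in> finite_measures N) \<and>
     (\<forall>Z\<in>sets N. emeasure Q Z = (\<Sum>t. emeasure (M t) Z))"

text \<open>
  The identity is the definition for indicators and extends to nonnegative functions by
  linearity and monotone convergence.
\<close>

lemma nn_integral_countable_sum:
  assumes Q: "is_countable_sum N M Q" and f: "f \<in> borel_measurable N"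
  shows "(\<integral>\<^sup>+z. f z \<partial>Q) = (\<Sum>t. \<integral>\<^sup>+z. f z \<partial>M t)"
proof -
  have sQ: "sets Q = sets N" and sM: "\<And>t. sets (M t) = sets N"
    and em: "\<And>Z. Z \<in> sets N \<Longrightarrow> emeasure Q Z = (\<Sum>t. emeasure (M t) Z)"
    using Q by (auto simp: is_countable_sum_def finite_measures_def)
  note meas = measurable_cong_sets[OF sQ refl] measurable_cong_sets[OF sM refl]
  show ?thesis
    using f
  proof (induction rule: borel_measurable_induct)
    case (cong f g)
    have sp: "space Q = space N" "\<And>t. space (M t) = space N"
      using sets_eq_imp_space_eq[OF sQ] sets_eq_imp_space_eq[OF sM] by auto
    have 1: "(\<integral>\<^sup>+z. f z \<partial>Q) = (\<integral>\<^sup>+z. g z \<partial>Q)"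
      using cong(3) sp by (intro nn_integral_cong) simp
    have 2: "(\<integral>\<^sup>+z. f z \<partial>M t) = (\<integral>\<^sup>+z. g z \<partial>M t)" for t
      using cong(3) sp by (intro nn_integral_cong) simp
    show ?case unfolding 1 2 by (rule cong)
  next
    case (set A)
    then show ?case using em sQ sM by simp
  next
    case (mult u c)
    then have "u \<in> borel_measurable Q" "\<And>t. u \<in> borel_measurable (M t)"
      by (simp_all add: meas)
    with mult show ?case by (simp add: nn_integral_cmult)
  next
    case (add u v)
    then have "u \<in> borel_measurable Q" "\<And>t. u \<in> borel_measurable (M t)"
       "v \<in> borel_measurable Q" "\<And>t. v \<in> borel_measurable (M t)"
      by (simp_all add: meas)
    with add show ?case by (simp add: nn_integral_add suminf_add)
  next
    case (seq U)
    then have m: "\<And>i. U i \<in> borel_measurable Q" "\<And>i t. U i \<in> borel_measurable (M t)"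
      by (simp_all add: meas)
    have "(\<integral>\<^sup>+z. (SUP i. U i) z \<partial>Q) = (SUP i. \<integral>\<^sup>+z. U i z \<partial>Q)"
      unfolding SUP_apply by (rule nn_integral_monotone_convergence_SUP) (use seq m in auto)
    also have "\<dots> = (SUP i. \<Sum>t. \<integral>\<^sup>+z. U i z \<partial>M t)"
      using seq by simp
    also have "\<dots> = (\<Sum>t. SUP i. \<integral>\<^sup>+z. U i z \<partial>M t)"
      by (rule ennreal_suminf_SUP_eq[symmetric])
         (use \<open>incseq U\<close> in \<open>auto simp: incseq_def le_fun_def intro!: nn_integral_mono\<close>)
    also have "\<dots> = (\<Sum>t. \<integral>\<^sup>+z. (SUP i. U i) z \<partial>M t)"
      unfolding SUP_apply
      by (intro suminf_cong nn_integral_monotone_convergence_SUP[symmetric]) (use seq m in auto)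
    finally show ?case .
  qed
qed

lemma finite_countable_sum:
  assumes Q: "is_countable_sum N M Q"
    and tail: "(\<Sum>t. emeasure (M (n + t)) (space N)) \<le> ennreal c"
  shows "Q \<in> finite_measures N"
proof -
  have sQ: "sets Q = sets N" and M: "\<And>t. M t \<in> finite_measures N"
    and em: "emeasure Q (space N) = (\<Sum>t. emeasure (M t) (space N))"
    using Q by (auto simp: is_countable_sum_def)
  have "emeasure Q (space N) =
      (\<Sum>t. emeasure (M (n + t)) (space N)) + (\<Sum>t<n. emeasure (M t) (space N))"
    unfolding em by (subst suminf_offset[where i = n]) (auto simp: add.commute)
  moreover have "(\<Sum>t. emeasure (M (n + t)) (space N)) < \<infinity>"
    using tail by (auto simp: le_less_trans)
  moreover have "(\<Sum>t<n. emeasure (M t) (space N)) < \<infinity>"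
    using M by (auto simp: finite_measures_def less_top[symmetric] finite_measure.emeasure_finite)
  ultimately have "emeasure Q (space Q) \<noteq> \<infinity>"
    by (simp add: sets_eq_imp_space_eq[OF sQ] less_top[symmetric])
  then show ?thesis
    using sQ by (auto simp: finite_measures_def intro!: finite_measureI)
qed

text \<open>
  The one-sided half of the comparison of two sums: the terms before \<open>n\<close> are compared one by
  one in total variation, the terms of \<open>Q\<close> from \<open>n\<close> on are bounded by their total mass, and
  those of \<open>Q'\<close> are nonnegative and may be added.  This last step needs \<open>h \<ge> 0\<close>.
\<close>

lemma integral_countable_sum_le:
  assumes Q: "is_countable_sum N M Q" and Q': "is_countable_sum N M' Q'"
    and fin: "Q \<in> finite_measures N" "Q' \<in> finite_measures N"
    and tail: "(\<Sum>t. emeasure (M (n + t)) (space N)) \<le> ennreal c" and c: "0 \<le> c"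
    and h: "h \<in> borel_measurable N" "\<And>z. z \<in> space N \<Longrightarrow> 0 \<le> h z \<and> h z \<le> (1::real)"
  shows "(\<integral>z. h z \<partial>Q) \<le> (\<integral>z. h z \<partial>Q') + ((\<Sum>t<n. tv_dist N (M t) (M' t)) + c)"
proof -
  have M: "\<And>t. M t \<in> finite_measures N" and M': "\<And>t. M' t \<in> finite_measures N"
    using Q Q' by (auto simp: is_countable_sum_def)
  have test: "h \<in> tv_test_functions N"
    using h by (auto simp: tv_test_functions_def)
  have pos: "AE z in R. 0 \<le> h z" "space R = space N" if "R \<in> finite_measures N" for R
    using that h by (auto simp: finite_measures_def dest!: sets_eq_imp_space_eq intro!: AE_I2)
  have nn: "(\<integral>\<^sup>+z. ennreal (h z) \<partial>R) = ennreal (\<integral>z. h z \<partial>R)" "0 \<le> (\<integral>z. h z \<partial>R)"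
    if "R \<in> finite_measures N" for R
    using nn_integral_eq_integral[OF integrable_tv_test_function(1)[OF that test] pos(1)[OF that]]
      integral_nonneg_AE[OF pos(1)[OF that]] by auto
  have hm: "(\<lambda>z. ennreal (h z)) \<in> borel_measurable N"
    using h(1) by simp
  let ?S = "\<Sum>t<n. tv_dist N (M t) (M' t)"
  have S: "0 \<le> ?S" by (intro sum_nonneg tv_dist_nonneg)
  have "ennreal (\<integral>z. h z \<partial>Q) = (\<Sum>t. \<integral>\<^sup>+z. h z \<partial>M t)"
    by (simp add: nn(1)[OF fin(1), symmetric] nn_integral_countable_sum[OF Q hm])
  also have "\<dots> = (\<Sum>t. \<integral>\<^sup>+z. h z \<partial>M (n + t)) + (\<Sum>t<n. \<integral>\<^sup>+z. h z \<partial>M t)"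
    by (subst suminf_offset[where i = n]) (auto simp: add.commute)
  also have "\<dots> \<le> ennreal c + (\<Sum>t<n. ennreal (\<integral>z. h z \<partial>M' t) + ennreal (tv_dist N (M t) (M' t)))"
  proof (intro add_mono sum_mono)
    have "(\<integral>\<^sup>+z. h z \<partial>M t) \<le> emeasure (M t) (space N)" for t
    proof -
      have "(\<integral>\<^sup>+z. h z \<partial>M t) \<le> (\<integral>\<^sup>+z. 1 \<partial>M t)"
        using h(2) pos(2)[OF M] by (intro nn_integral_mono) (auto simp: ennreal_le_1)
      then show ?thesis by (simp add: pos(2)[OF M])
    qed
    then have "(\<Sum>t. \<integral>\<^sup>+z. h z \<partial>M (n + t)) \<le> (\<Sum>t. emeasure (M (n + t)) (space N))"
      by (intro suminf_le) auto
    with tail show "(\<Sum>t. \<integral>\<^sup>+z. h z \<partial>M (n + t)) \<le> ennreal c" by (rule order_trans[rotated])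
    fix t
    show "(\<integral>\<^sup>+z. h z \<partial>M t) \<le> ennreal (\<integral>z. h z \<partial>M' t) + ennreal (tv_dist N (M t) (M' t))"
      using tv_dist_upper[OF M[of t] M'[of t] test] nn[OF M, of t] nn[OF M', of t]
      by (simp add: ennreal_plus[symmetric] tv_dist_nonneg del: ennreal_plus)
  qed
  also have "\<dots> = (\<Sum>t<n. \<integral>\<^sup>+z. h z \<partial>M' t) + ennreal (?S + c)"
    using c S by (simp add: sum.distrib nn(1)[OF M'] sum_ennreal tv_dist_nonneg ac_simps)
  also have "\<dots> \<le> (\<Sum>t. \<integral>\<^sup>+z. h z \<partial>M' t) + ennreal (?S + c)"
    by (intro add_mono sum_le_suminf) auto
  also have "\<dots> = ennreal (\<integral>z. h z \<partial>Q') + ennreal (?S + c)"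
    by (simp only: nn(1)[OF fin(2), symmetric] nn_integral_countable_sum[OF Q' hm])
  also have "\<dots> = ennreal ((\<integral>z. h z \<partial>Q') + (?S + c))"
    using c S nn(2)[OF fin(2)] by (simp add: ennreal_plus[symmetric] del: ennreal_plus)
  finally show ?thesis
    using c S nn(2)[OF fin(2)] by (subst (asm) ennreal_le_iff) auto
qed

text \<open>
  The factor 2 stems from splitting a test function into its positive and negative part, each
  of which takes values in \<open>[0, 1]\<close>.
\<close>

lemma tv_dist_countable_sum_le:
  assumes Q: "is_countable_sum N M Q" and Q': "is_countable_sum N M' Q'"
    and c: "0 \<le> c"
    and tail: "(\<Sum>t. emeasure (M (n + t)) (space N)) \<le> ennreal c"
    and tail': "(\<Sum>t. emeasure (M' (n + t)) (space N)) \<le> ennreal c"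
  shows "tv_dist N Q Q' \<le> 2 * ((\<Sum>t<n. tv_dist N (M t) (M' t)) + c)"
proof -
  have fin: "Q \<in> finite_measures N" "Q' \<in> finite_measures N"
    using finite_countable_sum[OF Q tail] finite_countable_sum[OF Q' tail'] .
  let ?b = "(\<Sum>t<n. tv_dist N (M t) (M' t)) + c"
  have comm: "tv_dist N (M' t) (M t) = tv_dist N (M t) (M' t)" for t
    using Metric_space.commute[OF Metric_space_tv_dist] .
  have bound: "\<bar>(\<integral>z. h z \<partial>Q) - (\<integral>z. h z \<partial>Q')\<bar> \<le> ?b"
    if "h \<in> borel_measurable N" "\<And>z. z \<in> space N \<Longrightarrow> 0 \<le> h z \<and> h z \<le> (1::real)" for h
    using integral_countable_sum_le[OF Q Q' fin tail c that]
      integral_countable_sum_le[OF Q' Q fin(2,1) tail' c that] by (simp add: comm abs_le_iff)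
  show ?thesis
  proof (rule tv_dist_least[OF fin])
    fix f assume f: "f \<in> tv_test_functions N"
    let ?p = "\<lambda>z. max 0 (f z)" and ?m = "\<lambda>z. max 0 (- f z)"
    have fm: "f \<in> borel_measurable N" and fb: "\<And>z. z \<in> space N \<Longrightarrow> \<bar>f z\<bar> \<le> 1"
      using f by (auto simp: tv_test_functions_def)
    have pm: "?p \<in> borel_measurable N" "?m \<in> borel_measurable N"
      using fm by auto
    have rng: "0 \<le> ?p z \<and> ?p z \<le> 1" "0 \<le> ?m z \<and> ?m z \<le> 1" if "z \<in> space N" for z
      using fb[OF that] by auto
    have "?p \<in> tv_test_functions N" "?m \<in> tv_test_functions N"
      using pm rng by (auto simp: tv_test_functions_def)
    then have "(\<integral>z. ?p z - ?m z \<partial>R) = (\<integral>z. ?p z \<partial>R) - (\<integral>z. ?m z \<partial>R)"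
      if "R \<in> finite_measures N" for R
      using integrable_tv_test_function(1)[OF that] by simp
    moreover have "(\<lambda>z. ?p z - ?m z) = f" by (auto simp: max_def)
    ultimately have split: "(\<integral>z. f z \<partial>R) = (\<integral>z. ?p z \<partial>R) - (\<integral>z. ?m z \<partial>R)"
      if "R \<in> finite_measures N" for R
      using that by simp
    show "\<bar>(\<integral>z. f z \<partial>Q) - (\<integral>z. f z \<partial>Q')\<bar> \<le> 2 * ?b"
      using bound[OF pm(1)] bound[OF pm(2)] rng split[OF fin(1)] split[OF fin(2)]
      by fastforce
  qed
qed

section \<open>Setwise convergence\<close>

text \<open>
  A function bounded by \<open>B\<close> is \<open>B\<close> times a test function, so its integral is a Lipschitz
  function of the measure in total variation.
\<close>

lemma continuous_map_tv_setwise: "continuous_map (tv_topology N) (setwise_topology N) id"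
  unfolding setwise_topology_def
proof (rule continuous_on_generated_topo)
  interpret Metric_space "finite_measures N" "tv_dist N"
    by (rule Metric_space_tv_dist)
  show "id ` topspace (tv_topology N) \<subseteq> \<Union> {{\<eta> \<in> finite_measures N. (\<integral>z. f z \<partial>\<eta>) \<in> U} |
      (f :: 'a \<Rightarrow> real) U. f \<in> borel_measurable N \<and> bounded (f ` space N) \<and> open U}"
    using topspace_setwise_topology[of N]
    unfolding setwise_topology_def topology_generated_by_topspace by (simp add: topspace_tv_topology)
  fix V assume "V \<in> {{\<eta> \<in> finite_measures N. (\<integral>z. f z \<partial>\<eta>) \<in> U} |
      (f :: 'a \<Rightarrow> real) U. f \<in> borel_measurable N \<and> bounded (f ` space N) \<and> open U}"
  then obtain f :: "'a \<Rightarrow> real" and U where V: "V = {\<eta> \<in> finite_measures N. (\<integral>z. f z \<partial>\<eta>) \<in> U}"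
    and f: "f \<in> borel_measurable N" "bounded (f ` space N)" and U: "open U" by blast
  obtain B where B: "0 < B" "\<And>z. z \<in> space N \<Longrightarrow> \<bar>f z\<bar> \<le> B"
    using f(2) by (auto simp: bounded_pos)
  have test: "(\<lambda>z. f z / B) \<in> tv_test_functions N"
    using B f(1) by (auto simp: tv_test_functions_def)
  have "openin mtopology V"
    unfolding openin_mtopology
  proof (intro conjI allI impI)
    show "V \<subseteq> finite_measures N" using V by auto
    fix \<eta> assume "\<eta> \<in> V"
    then have \<eta>: "\<eta> \<in> finite_measures N" "(\<integral>z. f z \<partial>\<eta>) \<in> U" using V by auto
    then obtain e where e: "e > 0" "\<And>y. \<bar>y - (\<integral>z. f z \<partial>\<eta>)\<bar> < e \<Longrightarrow> y \<in> U"
      using U by (auto simp: open_dist dist_real_def)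
    have "mball \<eta> (e / B) \<subseteq> V"
    proof
      fix \<zeta> assume "\<zeta> \<in> mball \<eta> (e / B)"
      then have \<zeta>: "\<zeta> \<in> finite_measures N" "tv_dist N \<eta> \<zeta> < e / B" by auto
      have "\<bar>(\<integral>z. f z \<partial>\<eta>) - (\<integral>z. f z \<partial>\<zeta>)\<bar> / B \<le> tv_dist N \<eta> \<zeta>"
        using tv_dist_upper[OF \<eta>(1) \<zeta>(1) test] B(1)
        by (simp add: diff_divide_distrib[symmetric])
      then have "\<bar>(\<integral>z. f z \<partial>\<zeta>) - (\<integral>z. f z \<partial>\<eta>)\<bar> < e"
        using \<zeta>(2) B(1) by (simp add: field_simps abs_minus_commute)
      then show "\<zeta> \<in> V" using e \<zeta> V by auto
    qed
    then show "\<exists>r>0. mball \<eta> r \<subseteq> V" using e(1) B(1) by (intro exI[of _ "e / B"]) auto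
  qed
  moreover have "id -` V \<inter> topspace (tv_topology N) = V"
    using V by (auto simp: topspace_tv_topology)
  ultimately show "openin (tv_topology N) (id -` V \<inter> topspace (tv_topology N))"
    by (simp add: tv_topology_def)
qed

section \<open>Standard Borel spaces inject into the unit interval\<close>

lemma ternary_expansion_summable: "summable (\<lambda>n. of_bool (P n) * (1/3) ^ n :: real)"
  by (rule summable_comparison_test'[where g = "\<lambda>n. (1/3) ^ n" and N = 0]) auto

lemma ternary_expansion_bounds:
  "0 \<le> (\<Sum>n. of_bool (P n) * (1/3) ^ n :: real) \<and> (\<Sum>n. of_bool (P n) * (1/3) ^ n :: real) \<le> 3/2"
proof
  show "0 \<le> (\<Sum>n. of_bool (P n) * (1/3) ^ n :: real)"
    by (rule suminf_nonneg[OF ternary_expansion_summable]) auto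
  have "(\<Sum>n. of_bool (P n) * (1/3) ^ n :: real) \<le> (\<Sum>n. (1/3) ^ n)"
    by (rule suminf_le[OF _ ternary_expansion_summable]) auto
  also have "\<dots> = 3/2" by (simp add: suminf_geometric)
  finally show "(\<Sum>n. of_bool (P n) * (1/3) ^ n :: real) \<le> 3/2" .
qed

text \<open>
  In base 3 with digits 0 and 1 there is no carrying: the tail after the first digit
  contributes at most 1/2, so the leading digit can be read off the sum and the rest follows by
  recursion.
\<close>

lemma ternary_expansion_inj:
  fixes P Q :: "nat \<Rightarrow> bool"
  assumes "(\<Sum>n. of_bool (P n) * (1/3) ^ n :: real) = (\<Sum>n. of_bool (Q n) * (1/3) ^ n)"
  shows "P n = Q n"
proof -
  let ?S = "\<lambda>P. \<Sum>n. of_bool (P n) * (1/3) ^ n :: real"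
  note sm = ternary_expansion_summable and bd = ternary_expansion_bounds
  have rec: "?S P = of_bool (P 0) + ?S (\<lambda>n. P (Suc n)) / 3" for P
    using suminf_split_head[OF sm[of P]] suminf_mult[OF sm[of "\<lambda>n. P (Suc n)"], of "1/3"]
    by (simp add: mult.assoc mult.left_commute)
  show ?thesis using assms
  proof (induction n arbitrary: P Q)
    case 0
    show ?case
      using 0 rec[of P] rec[of Q] bd[of "\<lambda>n. P (Suc n)"] bd[of "\<lambda>n. Q (Suc n)"]
      by (cases "P 0"; cases "Q 0") auto
  next
    case (Suc n)
    have "P 0 = Q 0"
      using Suc.prems rec[of P] rec[of Q] bd[of "\<lambda>n. P (Suc n)"] bd[of "\<lambda>n. Q (Suc n)"]
      by (cases "P 0"; cases "Q 0") auto
    then have "?S (\<lambda>n. P (Suc n)) = ?S (\<lambda>n. Q (Suc n))"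
      using Suc.prems rec[of P] rec[of Q] by simp
    then show ?case by (rule Suc.IH)
  qed
qed

text \<open>
  A separable metric space has a countable family of open balls that separates its points, so
  recording as ternary digits in which of the balls a point lies determines the point.
\<close>

lemma standard_borel_real_injection:
  assumes "standard_borel M"
  obtains g :: "'b \<Rightarrow> real" where "g \<in> borel_measurable M" "inj_on g (space M)"
    "\<And>x. x \<in> space M \<Longrightarrow> 0 < g x \<and> g x < 1"
proof -
  obtain S :: "real topology" and B f g where S: "completely_metrizable_space S" "separable_space S"
    and f: "f \<in> M \<rightarrow>\<^sub>M restrict_space (borel_of S) B"
    and gf: "\<And>x. x \<in> space M \<Longrightarrow> g (f x) = x"
    using assms unfolding standard_borel_def by blast
  obtain X d where X: "Metric_space X d" "S = Metric_space.mtopology X d"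
    using S(1) by (auto simp: completely_metrizable_space_def)
  interpret Metric_space X d by (rule X)
  have tS: "topspace S = X" using X by simp
  obtain C where C: "countable C" "C \<subseteq> X" "S closure_of C = X"
    using S(2) by (auto simp: separable_space_def tS)
  have spS: "space (borel_of S) = X" and setS: "\<And>U. openin S U \<Longrightarrow> U \<in> sets (borel_of S)"
    unfolding borel_of_def using openin_subset[of S]
    by (auto simp: space_measure_of_conv sets_measure_of_conv tS)
  have f': "f \<in> M \<rightarrow>\<^sub>M borel_of S"
    using f by (simp add: measurable_restrict_space2_iff)
  \<comment> \<open>Balls of radius \<open>1 / (k + 1)\<close> around the points of the dense set.\<close>
  define V where "V n = (case from_nat_into (C \<times> (UNIV :: nat set)) n of
     (q, k) \<Rightarrow> mball q (1 / real (Suc k)))" for n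
  define P where "P x n \<longleftrightarrow> f x \<in> V n" for x n
  have "V n \<in> sets (borel_of S)" for n
    unfolding V_def by (intro setS) (simp add: X split: prod.split)
  then have Pm: "Measurable.pred M (\<lambda>x. P x n)" for n
    unfolding P_def using f' by measurable
  define h :: "'b \<Rightarrow> real" where "h x = (\<Sum>n. of_bool (P x n) * (1/3) ^ n)" for x
  have hm: "h \<in> borel_measurable M"
    unfolding h_def using Pm by measurable
  have "x = y" if xy: "x \<in> space M" "y \<in> space M" "h x = h y" for x y
  proof (rule ccontr)
    assume "x \<noteq> y"
    then have "f x \<noteq> f y" using gf[OF xy(1)] gf[OF xy(2)] by metis
    moreover have fx: "f x \<in> X" "f y \<in> X"
      using measurable_space[OF f'] xy spS by auto
    ultimately have "0 < d (f x) (f y)" by simp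
    then obtain k where k: "2 / real (Suc k) < d (f x) (f y)"
      using reals_Archimedean[of "d (f x) (f y) / 2"] by (auto simp: field_simps)
    have "f x \<in> mtopology closure_of C" using C(3) fx X by simp
    then obtain q where q: "q \<in> C" "q \<in> mball (f x) (1 / real (Suc k))"
      unfolding metric_closure_of by (auto dest: spec[of _ "1 / real (Suc k)"])
    then obtain n where n: "from_nat_into (C \<times> (UNIV :: nat set)) n = (q, k)"
      using from_nat_into_surj[of "C \<times> (UNIV :: nat set)" "(q, k)"] C(1) by auto
    have "P x n" using q C(2) fx by (auto simp: P_def V_def n commute)
    then have "P y n" using ternary_expansion_inj[of "P x" "P y" n] xy(3) by (simp add: h_def)
    then have "d q (f x) < 1 / real (Suc k)" "d q (f y) < 1 / real (Suc k)"
      using q by (auto simp: P_def V_def n commute)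
    then have "d (f x) (f y) < 2 / real (Suc k)"
      using triangle[of "f x" q "f y"] fx q C(2) commute[of q "f x"] by auto
    with k show False by simp
  qed
  then have "inj_on h (space M)" by (auto simp: inj_on_def)
  have rng: "0 \<le> h x \<and> h x \<le> 3/2" for x
    unfolding h_def by (rule ternary_expansion_bounds)
  show thesis
  proof
    show "(\<lambda>x. (h x + 1) / 3) \<in> borel_measurable M" using hm by simp
    show "inj_on (\<lambda>x. (h x + 1) / 3) (space M)"
      using \<open>inj_on h (space M)\<close> by (auto simp: inj_on_def)
    show "0 < (h x + 1) / 3 \<and> (h x + 1) / 3 < 1" for x using rng[of x] by auto
  qed
qed

lemma standard_borel_singleton:
  assumes "standard_borel M" "x \<in> space M"
  shows "{x} \<in> sets M"
proof -
  obtain g :: "_ \<Rightarrow> real" where g: "g \<in> borel_measurable M" "inj_on g (space M)"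
    using standard_borel_real_injection[OF assms(1)] by metis
  have "g -` {g x} \<inter> space M \<in> sets M"
    using g(1) by (rule measurable_sets) simp
  moreover have "g -` {g x} \<inter> space M = {x}"
    using g(2) assms(2) by (auto dest: inj_onD)
  ultimately show ?thesis by simp
qed

section \<open>Point masses and restricted products\<close>

lemma prob_space_eqI_point:
  assumes M: "prob_space M" "emeasure M {a} = 1" and N: "prob_space N" "emeasure N {a} = 1"
    and s: "sets M = sets N"
  shows "M = N"
proof -
  have *: "emeasure R B = indicator B a" if R: "prob_space R" "emeasure R {a} = 1" and B: "B \<in> sets R"
    for R :: "'a measure" and B
  proof -
    interpret prob_space R by fact
    have a: "{a} \<in> sets R" using R(2) emeasure_notin_sets[of "{a}" R] by auto
    then have "AE x in R. x \<in> {a}"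
      using R(2) by (intro AE_in_set_eq_1[THEN iffD2]) (auto simp: measure_def)
    then have "emeasure R B = emeasure R (if a \<in> B then space R else {})"
      using B by (intro emeasure_eq_AE) (auto elim!: AE_mp)
    then show ?thesis by (simp add: emeasure_space_1)
  qed
  show ?thesis
    using *[OF M] *[OF N] s by (intro measure_eqI) auto
qed

lemma sets_restrict_pair_measure_fst:
  "sets (restrict_space M A \<Otimes>\<^sub>M N) =
   sets (restrict_space (M \<Otimes>\<^sub>M N) ((A \<inter> space M) \<times> space N))"
proof (intro equalityI subsetI)
  let ?L = "restrict_space M A \<Otimes>\<^sub>M N" and ?R = "restrict_space (M \<Otimes>\<^sub>M N) ((A \<inter> space M) \<times> space N)"
  have sp: "space ?L = (A \<inter> space M) \<times> space N" "space ?R = (A \<inter> space M) \<times> space N"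
    by (auto simp: space_pair_measure space_restrict_space)
  have 1: "(\<lambda>z. (fst z, snd z)) \<in> ?L \<rightarrow>\<^sub>M ?R"
    by (intro measurable_restrict_space2 measurable_Pair
        measurable_compose[OF measurable_fst measurable_restrict_space1[OF measurable_ident_sets[OF refl]]]
        measurable_snd)
       (auto simp: sp)
  have 2: "(\<lambda>z. (fst z, snd z)) \<in> ?R \<rightarrow>\<^sub>M ?L"
    by (intro measurable_Pair measurable_restrict_space2 measurable_restrict_space1
        measurable_fst measurable_snd) (auto simp: sp)
  show "Z \<in> sets ?R" if "Z \<in> sets ?L" for Z
    using measurable_sets[OF 2 that] sets.sets_into_space[OF that] by (simp add: sp Int_absorb2)
  show "Z \<in> sets ?L" if "Z \<in> sets ?R" for Z
    using measurable_sets[OF 1 that] sets.sets_into_space[OF that] by (simp add: sp Int_absorb2)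
qed

section \<open>One step of the trajectory measure\<close>

context Ionescu_Tulcea
begin

lemma CI_Ico: "CI {0..<n} = C 0 n (\<lambda>_. undefined)"
proof -
  have u: "up_to {0..<n} = n"
    using up_to_less[of "{0..<n}" "up_to {0..<n}"] by (intro antisym) (fastforce simp: up_to_iff)+
  have "C 0 n (\<lambda>_. undefined) = distr (C 0 n (\<lambda>_. undefined)) (PiM {0..<n} M) (\<lambda>x. restrict x {0..<n})"
    using distr_C[of n n "\<lambda>_. undefined" 0] by (simp add: space_PiM)
  then show ?thesis by (simp add: CI_def u)
qed

text \<open>
  In the projective limit, coordinate \<open>t\<close> has conditional law \<open>P t\<close> given the coordinates
  before it.  Only finitely many coordinates occur, so the claim reduces to the recursion by
  which the finite-dimensional laws are built.
\<close>

lemma nn_integral_lim_step: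
  assumes f: "f \<in> borel_measurable (PiM {0..<t} M \<Otimes>\<^sub>M M t)"
  shows "(\<integral>\<^sup>+\<omega>. f (restrict \<omega> {0..<t}, \<omega> t) \<partial>PF.lim)
    = (\<integral>\<^sup>+\<omega>. \<integral>\<^sup>+z. f (restrict \<omega> {0..<t}, z) \<partial>P t (restrict \<omega> {0..<t}) \<partial>PF.lim)"
proof -
  let ?u = "\<lambda>_::nat. undefined :: 'a"
  have u: "?u \<in> space (PiM {0..<0} M)" by (simp add: space_PiM)
  have lim: "distr PF.lim (PiM {0..<n} M) (\<lambda>\<omega>. restrict \<omega> {0..<n}) = C 0 n ?u" for n
    by (simp add: distr_lim CI_Ico)
  have r: "(\<lambda>\<omega>. restrict \<omega> {0..<n}) \<in> PF.lim \<rightarrow>\<^sub>M PiM {0..<n} M" for n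
    by (intro measurable_restrict) (simp add: measurable_cong_sets[OF PF.sets_lim refl])
  let ?g = "\<lambda>\<omega>. f (restrict \<omega> {0..<t}, \<omega> t)"
  let ?h = "\<lambda>\<omega>. \<integral>\<^sup>+z. f (\<omega>, z) \<partial>P t \<omega>"
  have gm: "?g \<in> borel_measurable (PiM {0..<Suc t} M)"
    by (rule measurable_compose[OF _ f]) (auto intro!: measurable_Pair measurable_restrict)
  have hm: "?h \<in> borel_measurable (PiM {0..<t} M)"
    by (rule nn_integral_measurable_subprob_algebra2[OF _ P]) (use f in simp)
  have "(\<integral>\<^sup>+\<omega>. ?g \<omega> \<partial>PF.lim) = (\<integral>\<^sup>+\<omega>. ?g (restrict \<omega> {0..<Suc t}) \<partial>PF.lim)"
    by (intro nn_integral_cong arg_cong[where f = f]) (auto simp: restrict_def fun_eq_iff)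
  also have "\<dots> = (\<integral>\<^sup>+\<omega>. ?g \<omega> \<partial>C 0 (Suc t) ?u)"
    unfolding lim[symmetric] by (rule nn_integral_distr[OF r, symmetric]) (use gm in simp)
  also have "\<dots> = (\<integral>\<^sup>+\<omega>. \<integral>\<^sup>+\<eta>. ?g \<eta> \<partial>eP t \<omega> \<partial>C 0 t ?u)"
    using gm u by (simp add: nn_integral_bind[where B = "PiM {0..<Suc t} M"] sets_C
        measurable_cong_sets[OF sets_C[OF u] refl])
  also have "\<dots> = (\<integral>\<^sup>+\<omega>. ?h \<omega> \<partial>C 0 t ?u)"
  proof (rule nn_integral_cong)
    fix \<omega> assume "\<omega> \<in> space (C 0 t ?u)"
    then have \<omega>: "\<omega> \<in> space (PiM {0..<t} M)" using space_C[OF u] by simp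
    then have "restrict (fun_upd \<omega> t z) {0..<t} = \<omega>" for z
      by (auto simp: space_PiM PiE_def extensional_def restrict_def fun_eq_iff)
    then show "(\<integral>\<^sup>+\<eta>. ?g \<eta> \<partial>eP t \<omega>) = ?h \<omega>"
      by (simp add: nn_integral_eP[OF \<omega> gm])
  qed
  also have "\<dots> = (\<integral>\<^sup>+\<omega>. ?h (restrict \<omega> {0..<t}) \<partial>PF.lim)"
    unfolding lim[symmetric] by (rule nn_integral_distr[OF r]) (use hm in simp)
  finally show ?thesis .
qed

end

section \<open>Marginal laws under stationary policies\<close>

context mdp
begin

definition admissible_kernel :: "('x \<Rightarrow> 'a measure) \<Rightarrow> bool" where
  "admissible_kernel \<kappa> \<longleftrightarrow> \<kappa> \<in> SX \<rightarrow>\<^sub>M prob_algebra SA \<and> (\<forall>x\<in>space SX. emeasure (\<kappa> x) (Act x) = 1)"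

definition deterministic_kernel :: "('x \<Rightarrow> 'a measure) \<Rightarrow> bool" where
  "deterministic_kernel \<kappa> \<longleftrightarrow> admissible_kernel \<kappa> \<and>
     (\<forall>x\<in>space SX. \<exists>a\<in>space SA. emeasure (\<kappa> x) {a} = 1)"

text \<open>
  A stationary policy is determined by a kernel on genuine histories only, so a policy need
  not equal the stationary policy built from its kernel; it merely agrees with it there.
\<close>

definition follows :: "(nat \<Rightarrow> (nat \<Rightarrow> 'x \<times> 'a) \<times> 'x \<Rightarrow> 'a measure) \<Rightarrow> ('x \<Rightarrow> 'a measure) \<Rightarrow> bool" where
  "follows \<pi> \<kappa> \<longleftrightarrow> (\<forall>t. \<forall>h\<in>space (history t). \<pi> t h = \<kappa> (snd h))"

definition stationary_policy :: "('x \<Rightarrow> 'a measure) \<Rightarrow> nat \<Rightarrow> (nat \<Rightarrow> 'x \<times> 'a) \<times> 'x \<Rightarrow> 'a measure" where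
  "stationary_policy \<kappa> = (\<lambda>t h. \<kappa> (snd h))"

lemma follows_stationary_policy: "follows (stationary_policy \<kappa>) \<kappa>"
  by (simp add: follows_def stationary_policy_def)

lemma snd_history: "snd \<in> history t \<rightarrow>\<^sub>M SX"
  unfolding history_def by (rule measurable_snd)

lemma space_history: "h \<in> space (history t) \<longleftrightarrow> fst h \<in> space (PiM {0..<t} (\<lambda>_. SX \<Otimes>\<^sub>M SA)) \<and> snd h \<in> space SX"
  by (auto simp: history_def space_pair_measure mem_Times_iff)

lemma stationary_policy_deterministic:
  assumes "deterministic_kernel \<kappa>"
  shows "stationary_policy \<kappa> \<in> deterministic_policies"
proof -
  have "\<kappa> \<in> SX \<rightarrow>\<^sub>M prob_algebra SA"
    using assms by (simp add: deterministic_kernel_def admissible_kernel_def)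
  then have "(\<lambda>h. \<kappa> (snd h)) \<in> history t \<rightarrow>\<^sub>M prob_algebra SA" for t
    by (rule measurable_compose[OF snd_history])
  with assms show ?thesis
    by (auto simp: deterministic_policies_def policy_def nonrandomized_def stationary_def
        stationary_policy_def deterministic_kernel_def admissible_kernel_def space_history)
qed

text \<open>
  Stationarity provides \<open>\<kappa>\<close> as a bare function; its measurability is inherited from the policy
  at time 0, where a history consists of the current state alone.
\<close>

lemma deterministic_policy_kernel:
  assumes "\<pi> \<in> deterministic_policies"
  obtains \<kappa> where "deterministic_kernel \<kappa>" "follows \<pi> \<kappa>"
proof -
  obtain \<kappa> where \<kappa>: "follows \<pi> \<kappa>" and pol: "policy \<pi>" and nr: "nonrandomized \<pi>"
    using assms by (auto simp: deterministic_policies_def stationary_def follows_def)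
  let ?h = "\<lambda>x. ((\<lambda>_. undefined) :: nat \<Rightarrow> 'x \<times> 'a, x)"
  have h: "?h x \<in> space (history 0)" if "x \<in> space SX" for x
    using that by (simp add: space_history space_PiM)
  have eq: "\<kappa> x = \<pi> 0 (?h x)" if "x \<in> space SX" for x
    using \<kappa> h[OF that] by (auto simp: follows_def)
  have "?h \<in> SX \<rightarrow>\<^sub>M history 0"
    unfolding history_def by (intro measurable_Pair measurable_const measurable_ident_sets[OF refl]) (simp add: space_PiM)
  then have "(\<lambda>x. \<pi> 0 (?h x)) \<in> SX \<rightarrow>\<^sub>M prob_algebra SA"
    by (rule measurable_compose) (use pol in \<open>simp add: policy_def\<close>)
  then have "\<kappa> \<in> SX \<rightarrow>\<^sub>M prob_algebra SA"
    using eq by (simp cong: measurable_cong)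
  then have "deterministic_kernel \<kappa>"
    using pol nr h by (fastforce simp: deterministic_kernel_def admissible_kernel_def policy_def nonrandomized_def eq)
  with \<kappa> that show thesis by blast
qed

definition state_action :: "('x \<Rightarrow> 'a measure) \<Rightarrow> 'x \<Rightarrow> ('x \<times> 'a) measure" where
  "state_action \<kappa> x = \<kappa> x \<bind> (\<lambda>a. return (SX \<Otimes>\<^sub>M SA) (x, a))"

text \<open>
  The laws of \<open>x\<^sub>t\<close> and of \<open>(x\<^sub>t, a\<^sub>t)\<close> under a stationary policy, obtained by the Markov
  recursion without reference to trajectories; \<open>nn_integral_traj_coordinate\<close> identifies them
  with the marginals of the trajectory measure.
\<close>

primrec state_law :: "('x \<Rightarrow> 'a measure) \<Rightarrow> nat \<Rightarrow> 'x measure" where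
  "state_law \<kappa> 0 = mu"
| "state_law \<kappa> (Suc t) = state_law \<kappa> t \<bind> state_action \<kappa> \<bind> p"

definition law :: "('x \<Rightarrow> 'a measure) \<Rightarrow> nat \<Rightarrow> ('x \<times> 'a) measure" where
  "law \<kappa> t = state_law \<kappa> t \<bind> state_action \<kappa>"

lemma state_law_Suc: "state_law \<kappa> (Suc t) = law \<kappa> t \<bind> p"
  by (simp add: law_def)

lemma admissible_kernelD:
  assumes "admissible_kernel \<kappa>"
  shows "\<kappa> \<in> SX \<rightarrow>\<^sub>M prob_algebra SA"
    and "x \<in> space SX \<Longrightarrow> prob_space (\<kappa> x)"
    and "x \<in> space SX \<Longrightarrow> sets (\<kappa> x) = sets SA"
    and "x \<in> space SX \<Longrightarrow> AE a in \<kappa> x. a \<in> Act x"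
proof -
  show m: "\<kappa> \<in> SX \<rightarrow>\<^sub>M prob_algebra SA"
    using assms by (simp add: admissible_kernel_def)
  { assume x: "x \<in> space SX"
    show p: "prob_space (\<kappa> x)" and s: "sets (\<kappa> x) = sets SA"
      using measurable_space[OF m x] by (auto simp: space_prob_algebra)
    interpret prob_space "\<kappa> x" by (rule p)
    show "AE a in \<kappa> x. a \<in> Act x"
      using assms x Act_sets[OF x] s
      by (intro AE_in_set_eq_1[THEN iffD2]) (auto simp: admissible_kernel_def measure_def) }
qed

lemma measurable_state_action:
  assumes "admissible_kernel \<kappa>"
  shows "state_action \<kappa> \<in> SX \<rightarrow>\<^sub>M prob_algebra (SX \<Otimes>\<^sub>M SA)"
proof -
  note [measurable] = admissible_kernelD(1)[OF assms]
  show ?thesis unfolding state_action_def by measurable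
qed

lemma nn_integral_state_action:
  assumes \<kappa>: "admissible_kernel \<kappa>" and x: "x \<in> space SX" and f: "f \<in> borel_measurable (SX \<Otimes>\<^sub>M SA)"
  shows "(\<integral>\<^sup>+z. f z \<partial>state_action \<kappa> x) = (\<integral>\<^sup>+a. f (x, a) \<partial>\<kappa> x)"
proof -
  have s: "sets (\<kappa> x) = sets SA" by (rule admissible_kernelD(3)[OF \<kappa> x])
  have "(\<lambda>a. return (SX \<Otimes>\<^sub>M SA) (x, a)) \<in> SA \<rightarrow>\<^sub>M subprob_algebra (SX \<Otimes>\<^sub>M SA)"
    using x by measurable
  then have "(\<integral>\<^sup>+z. f z \<partial>state_action \<kappa> x) = (\<integral>\<^sup>+a. \<integral>\<^sup>+z. f z \<partial>return (SX \<Otimes>\<^sub>M SA) (x, a) \<partial>\<kappa> x)"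
    unfolding state_action_def
    by (intro nn_integral_bind[OF f]) (simp add: measurable_cong_sets[OF s refl])
  also have "\<dots> = (\<integral>\<^sup>+a. f (x, a) \<partial>\<kappa> x)"
    using x f sets_eq_imp_space_eq[OF s]
    by (intro nn_integral_cong nn_integral_return) (auto simp: space_pair_measure)
  finally show ?thesis .
qed

lemma state_law_prob:
  assumes "admissible_kernel \<kappa>"
  shows "state_law \<kappa> t \<in> space (prob_algebra SX)"
  by (induction t) (auto intro: initial bind_in_prob_algebra transition measurable_state_action[OF assms])

lemma law_prob:
  assumes "admissible_kernel \<kappa>"
  shows "law \<kappa> t \<in> space (prob_algebra (SX \<Otimes>\<^sub>M SA))"
  unfolding law_def
  by (intro bind_in_prob_algebra[OF state_law_prob] measurable_state_action assms)

lemma nn_integral_bind_state_action_fst: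
  assumes \<kappa>: "admissible_kernel \<kappa>" and \<mu>: "\<mu> \<in> space (prob_algebra SX)" and f: "f \<in> borel_measurable SX"
  shows "(\<integral>\<^sup>+z. f (fst z) \<partial>(\<mu> \<bind> state_action \<kappa>)) = (\<integral>\<^sup>+x. f x \<partial>\<mu>)"
proof -
  have m: "(\<lambda>z. f (fst z)) \<in> borel_measurable (SX \<Otimes>\<^sub>M SA)"
    by (rule measurable_compose[OF measurable_fst f])
  have "(\<integral>\<^sup>+z. f (fst z) \<partial>(\<mu> \<bind> state_action \<kappa>)) = (\<integral>\<^sup>+x. \<integral>\<^sup>+z. f (fst z) \<partial>state_action \<kappa> x \<partial>\<mu>)"
    by (rule nn_integral_bind_prob_algebra[OF \<mu> measurable_state_action[OF \<kappa>] m])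
  also have "\<dots> = (\<integral>\<^sup>+x. f x \<partial>\<mu>)"
  proof (rule nn_integral_cong)
    fix x assume "x \<in> space \<mu>"
    then have x: "x \<in> space SX"
      using \<mu> sets_eq_imp_space_eq by (auto simp: space_prob_algebra)
    show "(\<integral>\<^sup>+z. f (fst z) \<partial>state_action \<kappa> x) = f x"
      using prob_space.emeasure_space_1[OF admissible_kernelD(2)[OF \<kappa> x]]
      by (simp add: nn_integral_state_action[OF \<kappa> x m])
  qed
  finally show ?thesis .
qed

text \<open>
  Actions are almost surely available ones; this is what turns the assumptions on \<open>p (x, a)\<close>,
  made for available \<open>a\<close> only, into statements about the laws.
\<close>

lemma nn_integral_law_eq_0:
  assumes \<kappa>: "admissible_kernel \<kappa>" and f: "f \<in> borel_measurable (SX \<Otimes>\<^sub>M SA)"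
    and 0: "\<And>x a. x \<in> space SX \<Longrightarrow> a \<in> Act x \<Longrightarrow> f (x, a) = 0"
  shows "(\<integral>\<^sup>+z. f z \<partial>law \<kappa> t) = 0"
proof -
  have "(\<integral>\<^sup>+z. f z \<partial>law \<kappa> t) = (\<integral>\<^sup>+x. \<integral>\<^sup>+z. f z \<partial>state_action \<kappa> x \<partial>state_law \<kappa> t)"
    unfolding law_def
    by (rule nn_integral_bind_prob_algebra[OF state_law_prob measurable_state_action f]) (rule \<kappa>)+
  also have "\<dots> = (\<integral>\<^sup>+x. 0 \<partial>state_law \<kappa> t)"
  proof (rule nn_integral_cong)
    fix x assume "x \<in> space (state_law \<kappa> t)"
    then have x: "x \<in> space SX"
      using state_law_prob[OF \<kappa>, of t] sets_eq_imp_space_eq by (auto simp: space_prob_algebra)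
    have "(\<integral>\<^sup>+a. f (x, a) \<partial>\<kappa> x) = (\<integral>\<^sup>+a. 0 \<partial>\<kappa> x)"
      by (rule nn_integral_cong_AE) (use admissible_kernelD(4)[OF \<kappa> x] 0[OF x] in \<open>auto elim: AE_mp\<close>)
    then show "(\<integral>\<^sup>+z. f z \<partial>state_action \<kappa> x) = 0"
      by (simp add: nn_integral_state_action[OF \<kappa> x f])
  qed
  finally show ?thesis by simp
qed

text \<open>
  Going from the state to the state-action pair costs \<open>2 m D\<close>, where \<open>m\<close> is the law of the
  state under \<open>\<kappa>\<close>; going on to the next state costs nothing, because \<open>p\<close> is the same for both.
  Only the laws under \<open>\<kappa>\<close> appear in the bound, so that \<open>\<kappa>'\<close> may vary with \<open>D\<close>.
\<close>

lemma tv_dist_law_le: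
  assumes \<kappa>: "admissible_kernel \<kappa>" and \<kappa>': "admissible_kernel \<kappa>'"
    and D: "D \<in> sets SX" and eq: "\<And>x. x \<in> space SX - D \<Longrightarrow> \<kappa> x = \<kappa>' x"
  shows "tv_dist (SX \<Otimes>\<^sub>M SA) (law \<kappa> t) (law \<kappa>' t) \<le> 2 * (\<Sum>i\<le>t. measure (state_law \<kappa> i) D)"
proof -
  let ?N = "SX \<Otimes>\<^sub>M SA"
  have sa: "state_action \<kappa> x = state_action \<kappa>' x" if "x \<in> space SX - D" for x
    using eq[OF that] by (simp add: state_action_def)
  have law: "tv_dist ?N (law \<kappa> t) (law \<kappa>' t)
      \<le> 2 * measure (state_law \<kappa> t) D + tv_dist SX (state_law \<kappa> t) (state_law \<kappa>' t)" for t
  proof -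
    \<comment> \<open>The intermediate law starts from the first state law and uses the second kernel.\<close>
    let ?mid = "state_law \<kappa> t \<bind> state_action \<kappa>'"
    have "?mid \<in> space (prob_algebra ?N)"
      by (rule bind_in_prob_algebra[OF state_law_prob[OF \<kappa>] measurable_state_action[OF \<kappa>']])
    then have "tv_dist ?N (law \<kappa> t) (law \<kappa>' t) \<le> tv_dist ?N (law \<kappa> t) ?mid + tv_dist ?N ?mid (law \<kappa>' t)"
      by (intro Metric_space.triangle[OF Metric_space_tv_dist] prob_algebra_finite_measures law_prob \<kappa> \<kappa>')
    also have "tv_dist ?N (law \<kappa> t) ?mid \<le> 2 * measure (state_law \<kappa> t) D"
      unfolding law_def
      by (rule tv_dist_bind_kernels_le[OF state_law_prob measurable_state_action measurable_state_action D sa])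
         (use \<kappa> \<kappa>' in auto)
    also have "tv_dist ?N ?mid (law \<kappa>' t) \<le> tv_dist SX (state_law \<kappa> t) (state_law \<kappa>' t)"
      unfolding law_def by (intro tv_dist_bind_le state_law_prob measurable_state_action \<kappa> \<kappa>')
    finally show ?thesis by simp
  qed
  have "tv_dist SX (state_law \<kappa> t) (state_law \<kappa>' t) \<le> 2 * (\<Sum>i<t. measure (state_law \<kappa> i) D)"
  proof (induction t)
    case 0
    show ?case
      using Metric_space.mdist_zero[OF Metric_space_tv_dist prob_algebra_finite_measures[OF initial]] by simp
  next
    case (Suc t)
    have "tv_dist SX (state_law \<kappa> (Suc t)) (state_law \<kappa>' (Suc t)) \<le> tv_dist ?N (law \<kappa> t) (law \<kappa>' t)"
      unfolding state_law_Suc by (intro tv_dist_bind_le law_prob transition \<kappa> \<kappa>')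
    with law[of t] Suc.IH show ?case by simp
  qed
  with law[of t] show ?thesis by (simp add: lessThan_Suc_atMost[symmetric])
qed

lemma measurable_coordinate:
  assumes "policy \<pi>"
  shows "(\<lambda>\<omega>. \<omega> t) \<in> traj \<pi> \<rightarrow>\<^sub>M SX \<Otimes>\<^sub>M SA"
    and "prob_space (traj \<pi>)"
proof -
  interpret Ionescu_Tulcea "step \<pi>" "\<lambda>_. SX \<Otimes>\<^sub>M SA"
    by (rule Ionescu_Tulcea_step[OF assms])
  have s: "sets (traj \<pi>) = sets (PiM UNIV (\<lambda>_. SX \<Otimes>\<^sub>M SA))"
    by (simp add: traj_def)
  show "(\<lambda>\<omega>. \<omega> t) \<in> traj \<pi> \<rightarrow>\<^sub>M SX \<Otimes>\<^sub>M SA"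
    by (simp add: measurable_cong_sets[OF s refl])
  have "prob_space (distr PF.lim (PiM {} (\<lambda>_. SX \<Otimes>\<^sub>M SA)) (\<lambda>x. restrict x {}))"
    by (simp add: distr_lim PF.prob_space_P)
  then show "prob_space (traj \<pi>)"
    unfolding traj_def
    by (rule prob_space_distrD[rotated]) (simp add: measurable_cong_sets[OF PF.sets_lim refl] measurable_restrict)
qed

lemma step_follows:
  assumes fol: "follows \<pi> \<kappa>" and \<omega>: "\<omega> \<in> space (PiM {0..<t} (\<lambda>_. SX \<Otimes>\<^sub>M SA))"
  shows "step \<pi> t \<omega> = (if t = 0 then mu else p (\<omega> (t - 1))) \<bind> state_action \<kappa>"
  unfolding step_def
proof (rule bind_cong[OF refl])
  fix x assume x: "x \<in> space (if t = 0 then mu else p (\<omega> (t - 1)))"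
  have "(if t = 0 then mu else p (\<omega> (t - 1))) \<in> space (prob_algebra SX)"
    using \<omega> initial measurable_space[OF transition, of "\<omega> (t - 1)"]
    by (auto simp: space_PiM PiE_iff)
  then have "x \<in> space SX"
    using x sets_eq_imp_space_eq by (auto simp: space_prob_algebra)
  then have "(\<omega>, x) \<in> space (history t)"
    using \<omega> by (simp add: space_history)
  then show "\<pi> t (\<omega>, x) \<bind> (\<lambda>a. return (SX \<Otimes>\<^sub>M SA) (x, a)) = state_action \<kappa> x"
    using fol by (auto simp: state_action_def follows_def)
qed

lemma nn_integral_traj_start:
  assumes pol: "policy \<pi>" and fol: "follows \<pi> \<kappa>" and f: "f \<in> borel_measurable (SX \<Otimes>\<^sub>M SA)"
  shows "(\<integral>\<^sup>+\<omega>. f (\<omega> 0) \<partial>traj \<pi>) = (\<integral>\<^sup>+z. f z \<partial>law \<kappa> 0)"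
proof -
  interpret Ionescu_Tulcea "step \<pi>" "\<lambda>_. SX \<Otimes>\<^sub>M SA"
    by (rule Ionescu_Tulcea_step[OF pol])
  have traj: "traj \<pi> = PF.lim" by (simp add: traj_def)
  have "(\<integral>\<^sup>+\<omega>. f (\<omega> 0) \<partial>traj \<pi>) = (\<integral>\<^sup>+\<omega>. \<integral>\<^sup>+z. f z \<partial>step \<pi> 0 (restrict \<omega> {0..<0}) \<partial>traj \<pi>)"
    unfolding traj
    using nn_integral_lim_step[of "\<lambda>z. f (snd z)" 0, OF measurable_compose[OF measurable_snd f]] by simp
  also have "\<dots> = (\<integral>\<^sup>+\<omega>. \<integral>\<^sup>+z. f z \<partial>(mu \<bind> state_action \<kappa>) \<partial>traj \<pi>)"
  proof (rule nn_integral_cong)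
    fix \<omega> :: "nat \<Rightarrow> 'x \<times> 'a"
    have "restrict \<omega> {0..<0} \<in> space (PiM {0..<0} (\<lambda>_. SX \<Otimes>\<^sub>M SA))"
      by (auto simp: space_PiM PiE_iff)
    from step_follows[OF fol this]
    show "(\<integral>\<^sup>+z. f z \<partial>step \<pi> 0 (restrict \<omega> {0..<0})) = (\<integral>\<^sup>+z. f z \<partial>(mu \<bind> state_action \<kappa>))"
      by (simp only: if_True refl)
  qed
  also have "\<dots> = (\<integral>\<^sup>+z. f z \<partial>law \<kappa> 0)"
    using prob_space.emeasure_space_1[OF measurable_coordinate(2)[OF pol]] by (simp add: law_def)
  finally show ?thesis .
qed

text \<open>
  The Markov property for two consecutive times.  Joint laws of neighbours are needed for the
  absorption argument, which concerns the trajectories themselves.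
\<close>

lemma nn_integral_traj_step:
  assumes pol: "policy \<pi>" and fol: "follows \<pi> \<kappa>"
    and g: "g \<in> borel_measurable ((SX \<Otimes>\<^sub>M SA) \<Otimes>\<^sub>M (SX \<Otimes>\<^sub>M SA))"
  shows "(\<integral>\<^sup>+\<omega>. g (\<omega> t, \<omega> (Suc t)) \<partial>traj \<pi>)
    = (\<integral>\<^sup>+\<omega>. \<integral>\<^sup>+z. g (\<omega> t, z) \<partial>(p (\<omega> t) \<bind> state_action \<kappa>) \<partial>traj \<pi>)"
proof -
  let ?N = "SX \<Otimes>\<^sub>M SA"
  interpret Ionescu_Tulcea "step \<pi>" "\<lambda>_. ?N"
    by (rule Ionescu_Tulcea_step[OF pol])
  have traj: "traj \<pi> = PF.lim" by (simp add: traj_def)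
  let ?f = "\<lambda>z. g (fst z t, snd z)"
  have "(\<lambda>z. fst z t) \<in> PiM {0..<Suc t} (\<lambda>_. ?N) \<Otimes>\<^sub>M ?N \<rightarrow>\<^sub>M ?N"
    by (rule measurable_compose[OF measurable_fst measurable_component_singleton]) simp
  then have "?f \<in> borel_measurable (PiM {0..<Suc t} (\<lambda>_. ?N) \<Otimes>\<^sub>M ?N)"
    by (intro measurable_compose[OF _ g] measurable_Pair) auto
  from nn_integral_lim_step[OF this]
  have "(\<integral>\<^sup>+\<omega>. g (\<omega> t, \<omega> (Suc t)) \<partial>traj \<pi>)
      = (\<integral>\<^sup>+\<omega>. \<integral>\<^sup>+z. g (\<omega> t, z) \<partial>step \<pi> (Suc t) (restrict \<omega> {0..<Suc t}) \<partial>traj \<pi>)"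
    by (simp add: traj)
  also have "\<dots> = (\<integral>\<^sup>+\<omega>. \<integral>\<^sup>+z. g (\<omega> t, z) \<partial>(p (\<omega> t) \<bind> state_action \<kappa>) \<partial>traj \<pi>)"
  proof (rule nn_integral_cong)
    fix \<omega> assume "\<omega> \<in> space (traj \<pi>)"
    then have "restrict \<omega> {0..<Suc t} \<in> space (PiM {0..<Suc t} (\<lambda>_. ?N))"
      by (auto simp: traj space_PiM PiE_iff)
    from step_follows[OF fol this]
    show "(\<integral>\<^sup>+z. g (\<omega> t, z) \<partial>step \<pi> (Suc t) (restrict \<omega> {0..<Suc t}))
        = (\<integral>\<^sup>+z. g (\<omega> t, z) \<partial>(p (\<omega> t) \<bind> state_action \<kappa>))"
      by simp
  qed
  finally show ?thesis .
qed

lemma nn_integral_traj_coordinate: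
  assumes pol: "policy \<pi>" and \<kappa>: "admissible_kernel \<kappa>" and fol: "follows \<pi> \<kappa>"
    and f: "f \<in> borel_measurable (SX \<Otimes>\<^sub>M SA)"
  shows "(\<integral>\<^sup>+\<omega>. f (\<omega> t) \<partial>traj \<pi>) = (\<integral>\<^sup>+z. f z \<partial>law \<kappa> t)"
  using f
proof (induction t arbitrary: f)
  case 0
  show ?case by (rule nn_integral_traj_start[OF pol fol 0])
next
  case (Suc t)
  let ?N = "SX \<Otimes>\<^sub>M SA"
  have sa: "(\<lambda>w. p w \<bind> state_action \<kappa>) \<in> ?N \<rightarrow>\<^sub>M prob_algebra ?N"
    by (rule measurable_bind_prob_space[OF transition measurable_state_action[OF \<kappa>]])
  have "(\<integral>\<^sup>+\<omega>. f (\<omega> (Suc t)) \<partial>traj \<pi>) = (\<integral>\<^sup>+\<omega>. \<integral>\<^sup>+z. f z \<partial>(p (\<omega> t) \<bind> state_action \<kappa>) \<partial>traj \<pi>)"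
    using nn_integral_traj_step[OF pol fol measurable_compose[OF measurable_snd Suc.prems], of t]
    by (simp only: snd_conv)
  also have "\<dots> = (\<integral>\<^sup>+w. \<integral>\<^sup>+z. f z \<partial>(p w \<bind> state_action \<kappa>) \<partial>law \<kappa> t)"
    by (rule Suc.IH)
       (rule measurable_compose[OF measurable_prob_algebraD[OF sa]
          nn_integral_measurable_subprob_algebra[OF Suc.prems]])
  also have "\<dots> = (\<integral>\<^sup>+z. f z \<partial>(law \<kappa> t \<bind> (\<lambda>w. p w \<bind> state_action \<kappa>)))"
    by (rule nn_integral_bind_prob_algebra[OF law_prob[OF \<kappa>] sa Suc.prems, symmetric])
  also have "law \<kappa> t \<bind> (\<lambda>w. p w \<bind> state_action \<kappa>) = law \<kappa> (Suc t)"
  proof -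
    have s: "sets (law \<kappa> t) = sets ?N"
      using law_prob[OF \<kappa>, of t] by (simp add: space_prob_algebra)
    have "p \<in> law \<kappa> t \<rightarrow>\<^sub>M subprob_algebra SX"
      using measurable_prob_algebraD[OF transition] by (simp only: measurable_cong_sets[OF s refl])
    then show ?thesis
      unfolding law_def[of \<kappa> "Suc t"] state_law_Suc
      by (rule bind_assoc[symmetric]) (rule measurable_prob_algebraD[OF measurable_state_action[OF \<kappa>]])
  qed
  finally show ?case .
qed

end

section \<open>Absorption\<close>

context absorbing_mdp
begin

lemma singleton_sets: "x \<in> space SX \<Longrightarrow> {x} \<in> sets SX"
  by (rule standard_borel_singleton[OF standard_borel_SX])

lemma transition_prob: "x \<in> space SX \<Longrightarrow> a \<in> Act x \<Longrightarrow> p (x, a) \<in> space (prob_algebra SX)"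
  using measurable_space[OF transition, of "(x, a)"] sets.sets_into_space[OF Act_sets]
  by (auto simp: space_pair_measure)

lemma no_escape:
  assumes "a \<in> Act xbar"
  shows "emeasure (p (xbar, a)) (space SX - {xbar}) = 0"
proof -
  have p: "sets (p (xbar, a)) = sets SX" "prob_space (p (xbar, a))"
    using transition_prob[OF xbar_space assms] by (auto simp: space_prob_algebra)
  then interpret prob_space "p (xbar, a)" by simp
  have "emeasure (p (xbar, a)) {xbar} = 1"
    using absorbing_xbar assms by auto
  then have "emeasure (p (xbar, a)) (space (p (xbar, a)) - {xbar}) = 0"
    using singleton_sets[OF xbar_space] p(1) xbar_space sets_eq_imp_space_eq[OF p(1)] emeasure_space_1
    by (subst emeasure_Diff) auto
  then show ?thesis by (simp add: sets_eq_imp_space_eq[OF p(1)])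
qed

text \<open>
  For each \<open>t\<close> the event \<open>x\<^sub>t = xbar \<noteq> x\<^sub>t\<^sub>+\<^sub>1\<close> is null, since from \<open>xbar\<close> the only available action
  leads back to \<open>xbar\<close> with probability one.
\<close>

lemma AE_absorbed:
  assumes pol: "policy \<pi>" and \<kappa>: "admissible_kernel \<kappa>" and fol: "follows \<pi> \<kappa>"
  shows "AE \<omega> in traj \<pi>. \<forall>t. fst (\<omega> t) = xbar \<longrightarrow> fst (\<omega> (Suc t)) = xbar"
proof -
  let ?N = "SX \<Otimes>\<^sub>M SA"
  have X[measurable]: "{xbar} \<in> sets SX" by (rule singleton_sets[OF xbar_space])
  note [measurable] = measurable_coordinate(1)[OF pol] transition
  have "AE \<omega> in traj \<pi>. fst (\<omega> t) = xbar \<longrightarrow> fst (\<omega> (Suc t)) = xbar" for t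
  proof -
    let ?i = "indicator {xbar} :: 'x \<Rightarrow> ennreal" and ?j = "indicator (space SX - {xbar}) :: 'x \<Rightarrow> ennreal"
    let ?g = "\<lambda>(w, z). ?i (fst w) * ?j (fst z)"
    have g: "?g \<in> borel_measurable (?N \<Otimes>\<^sub>M ?N)"
      by measurable
    let ?G = "\<lambda>w. ?i (fst w) * emeasure (p w) (space SX - {xbar})"
    have Gm: "?G \<in> borel_measurable ?N"
    proof -
      have "(\<lambda>w. emeasure (p w) (space SX - {xbar})) \<in> borel_measurable ?N"
        by (rule measurable_compose[OF measurable_prob_algebraD[OF transition]
              measurable_emeasure_subprob_algebra]) measurable
      then show ?thesis by measurable
    qed
    have "(\<integral>\<^sup>+\<omega>. ?g (\<omega> t, \<omega> (Suc t)) \<partial>traj \<pi>)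
        = (\<integral>\<^sup>+\<omega>. \<integral>\<^sup>+z. ?g (\<omega> t, z) \<partial>(p (\<omega> t) \<bind> state_action \<kappa>) \<partial>traj \<pi>)"
      by (rule nn_integral_traj_step[OF pol fol g])
    also have "\<dots> = (\<integral>\<^sup>+\<omega>. ?G (\<omega> t) \<partial>traj \<pi>)"
    proof (rule nn_integral_cong)
      fix \<omega> assume "\<omega> \<in> space (traj \<pi>)"
      then have "\<omega> t \<in> space ?N"
        by (rule measurable_space[OF measurable_coordinate(1)[OF pol]])
      then have w: "p (\<omega> t) \<in> space (prob_algebra SX)"
        by (rule measurable_space[OF transition])
      then have s: "sets (p (\<omega> t)) = sets SX" by (simp add: space_prob_algebra)
      have c: "(\<lambda>x. ?i (fst (\<omega> t)) * ?j x) \<in> borel_measurable SX" by measurable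
      have "(\<integral>\<^sup>+z. ?g (\<omega> t, z) \<partial>(p (\<omega> t) \<bind> state_action \<kappa>))
          = (\<integral>\<^sup>+x. ?i (fst (\<omega> t)) * ?j x \<partial>p (\<omega> t))"
        using nn_integral_bind_state_action_fst[OF \<kappa> w c] by simp
      also have "\<dots> = ?G (\<omega> t)"
        using s X by (subst nn_integral_cmult_indicator) auto
      finally show "(\<integral>\<^sup>+z. ?g (\<omega> t, z) \<partial>(p (\<omega> t) \<bind> state_action \<kappa>)) = ?G (\<omega> t)" .
    qed
    also have "\<dots> = (\<integral>\<^sup>+z. ?G z \<partial>law \<kappa> t)"
      by (rule nn_integral_traj_coordinate[OF pol \<kappa> fol Gm])
    also have "\<dots> = 0"
      by (rule nn_integral_law_eq_0[OF \<kappa> Gm]) (auto simp: no_escape indicator_def)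
    finally have "AE \<omega> in traj \<pi>. ?g (\<omega> t, \<omega> (Suc t)) = 0"
      by (subst (asm) nn_integral_0_iff_AE) (use measurable_compose[OF _ g] in measurable)
    then show ?thesis
    proof (rule AE_mp[OF _ AE_I2], intro impI)
      fix \<omega> assume \<omega>: "\<omega> \<in> space (traj \<pi>)" "?g (\<omega> t, \<omega> (Suc t)) = 0" "fst (\<omega> t) = xbar"
      then have "fst (\<omega> (Suc t)) \<in> space SX"
        using measurable_space[OF measurable_coordinate(1)[OF pol], of \<omega> "Suc t"]
        by (auto simp: space_pair_measure)
      with \<omega> show "fst (\<omega> (Suc t)) = xbar"
        by (auto simp: indicator_def split: if_splits)
    qed
  qed
  then show ?thesis by (simp add: AE_all_countable)
qed

lemma less_hitting_time:
  fixes \<omega> :: "nat \<Rightarrow> 'x \<times> 'a"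
  assumes "\<forall>t. fst (\<omega> t) = xbar \<longrightarrow> fst (\<omega> (Suc t)) = xbar" and "fst (\<omega> t) \<noteq> xbar"
  shows "enat t < hitting_time xbar \<omega>"
proof -
  have stay: "fst (\<omega> s) = xbar \<Longrightarrow> s \<le> u \<Longrightarrow> fst (\<omega> u) = xbar" for s u
    using assms(1) by (induction u) (auto simp: le_Suc_eq)
  have *: "enat (Suc t) \<le> e" if e: "e \<in> {enat s | s. fst (\<omega> s) = xbar}" for e
  proof -
    obtain s where s: "e = enat s" "fst (\<omega> s) = xbar" using e by blast
    then have "\<not> s \<le> t" using stay assms(2) by blast
    then show ?thesis using s(1) by simp
  qed
  have "enat t < enat (Suc t)" by simp
  also have "\<dots> \<le> hitting_time xbar \<omega>"
    unfolding hitting_time_def by (rule Inf_greatest) (rule *)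
  finally show ?thesis .
qed

definition live_pairs :: "('x \<times> 'a) set" where
  "live_pairs = (space SX - {xbar}) \<times> space SA"

lemma live_pairs:
  shows "live_pairs \<in> sets (SX \<Otimes>\<^sub>M SA)"
    and "sets (live \<Otimes>\<^sub>M SA) = sets (restrict_space (SX \<Otimes>\<^sub>M SA) live_pairs)"
    and "space (live \<Otimes>\<^sub>M SA) = live_pairs"
proof -
  show 1: "live_pairs \<in> sets (SX \<Otimes>\<^sub>M SA)"
    unfolding live_pairs_def using singleton_sets[OF xbar_space] by auto
  show 2: "sets (live \<Otimes>\<^sub>M SA) = sets (restrict_space (SX \<Otimes>\<^sub>M SA) live_pairs)"
    using sets_restrict_pair_measure_fst[of SX "space SX - {xbar}" SA]
    by (simp add: live_def live_pairs_def Int_absorb2)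
  show "space (live \<Otimes>\<^sub>M SA) = live_pairs"
    using sets_eq_imp_space_eq[OF 2] 1 by simp
qed

text \<open>
  The left-hand side counts the late times at which the process is outside \<open>xbar\<close>, the
  right-hand side those before the first visit to \<open>xbar\<close>.  As the process almost surely
  stays in \<open>xbar\<close>, these are the same times.
\<close>

lemma sum_law_tail_le:
  assumes pol: "policy \<pi>" and \<kappa>: "admissible_kernel \<kappa>" and fol: "follows \<pi> \<kappa>"
  shows "(\<Sum>t. emeasure (law \<kappa> (n + t)) live_pairs)
     \<le> (\<integral>\<^sup>+\<omega>. (\<Sum>t. if enat (n + t) < hitting_time xbar \<omega> then 1 else 0) \<partial>traj \<pi>)"
proof -
  have s: "sets (law \<kappa> t) = sets (SX \<Otimes>\<^sub>M SA)" for t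
    using law_prob[OF \<kappa>] by (simp add: space_prob_algebra)
  let ?i = "indicator live_pairs :: 'x \<times> 'a \<Rightarrow> ennreal"
  have i: "?i \<in> borel_measurable (SX \<Otimes>\<^sub>M SA)"
    using live_pairs(1) by simp
  have "(\<Sum>t. emeasure (law \<kappa> (n + t)) live_pairs) = (\<Sum>t. \<integral>\<^sup>+\<omega>. ?i (\<omega> (n + t)) \<partial>traj \<pi>)"
    using live_pairs(1) s by (simp add: nn_integral_traj_coordinate[OF pol \<kappa> fol i])
  also have "\<dots> = (\<integral>\<^sup>+\<omega>. (\<Sum>t. ?i (\<omega> (n + t))) \<partial>traj \<pi>)"
    by (rule nn_integral_suminf[symmetric]) (rule measurable_compose[OF measurable_coordinate(1)[OF pol] i])
  also have "\<dots> \<le> (\<integral>\<^sup>+\<omega>. (\<Sum>t. if enat (n + t) < hitting_time xbar \<omega> then 1 else 0) \<partial>traj \<pi>)"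
  proof (rule nn_integral_mono_AE, rule AE_mp[OF AE_absorbed[OF assms] AE_I2], intro impI suminf_le)
    fix \<omega> :: "nat \<Rightarrow> 'x \<times> 'a" and t
    assume "\<forall>t. fst (\<omega> t) = xbar \<longrightarrow> fst (\<omega> (Suc t)) = xbar"
    then show "?i (\<omega> (n + t)) \<le> (if enat (n + t) < hitting_time xbar \<omega> then 1 else 0)"
      using less_hitting_time[of \<omega> "n + t"] by (auto simp: indicator_def live_pairs_def mem_Times_iff)
  qed auto
  finally show ?thesis .
qed

lemma emeasure_restrict_law:
  assumes \<kappa>: "admissible_kernel \<kappa>" and Z: "Z \<subseteq> live_pairs"
  shows "emeasure (restrict_space (law \<kappa> t) live_pairs) Z = emeasure (law \<kappa> t) Z"
proof (rule emeasure_restrict_space)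
  have s: "sets (law \<kappa> t) = sets (SX \<Otimes>\<^sub>M SA)"
    using law_prob[OF \<kappa>] by (simp add: space_prob_algebra)
  then show "live_pairs \<inter> space (law \<kappa> t) \<in> sets (law \<kappa> t)"
    using live_pairs(1) by auto
  show "Z \<subseteq> live_pairs" by (rule Z)
qed

lemma occupancy_countable_sum:
  assumes pol: "policy \<pi>" and \<kappa>: "admissible_kernel \<kappa>" and fol: "follows \<pi> \<kappa>"
  shows "is_countable_sum (live \<Otimes>\<^sub>M SA) (\<lambda>t. restrict_space (law \<kappa> t) live_pairs) (occupancy \<pi>)"
  unfolding is_countable_sum_def
proof (intro conjI allI ballI)
  have s: "sets (law \<kappa> t) = sets (SX \<Otimes>\<^sub>M SA)" and p: "prob_space (law \<kappa> t)" for t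
    using law_prob[OF \<kappa>] by (auto simp: space_prob_algebra)
  show "sets (occupancy \<pi>) = sets (live \<Otimes>\<^sub>M SA)"
    unfolding occupancy_def by (rule sets.sets_measure_of_eq)
  show "restrict_space (law \<kappa> t) live_pairs \<in> finite_measures (live \<Otimes>\<^sub>M SA)" for t
    using live_pairs s p[of t]
    by (auto simp: finite_measures_def prob_space.finite_measure intro!: finite_measure_restrict_space
        cong: sets_restrict_space_cong)
  fix Z assume Z: "Z \<in> sets (live \<Otimes>\<^sub>M SA)"
  then have Z': "Z \<in> sets (SX \<Otimes>\<^sub>M SA)" "Z \<subseteq> live_pairs"
    using live_pairs by (auto simp: sets_restrict_space_iff)
  then have i: "(indicator Z :: _ \<Rightarrow> ennreal) \<in> borel_measurable (SX \<Otimes>\<^sub>M SA)" by simp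
  have "emeasure (traj \<pi>) {\<omega> \<in> space (traj \<pi>). \<omega> t \<in> Z} = emeasure (restrict_space (law \<kappa> t) live_pairs) Z" for t
  proof -
    have e: "{\<omega> \<in> space (traj \<pi>). \<omega> t \<in> Z} = (\<lambda>\<omega>. \<omega> t) -` Z \<inter> space (traj \<pi>)" by auto
    have m: "{\<omega> \<in> space (traj \<pi>). \<omega> t \<in> Z} \<in> sets (traj \<pi>)"
      unfolding e by (rule measurable_sets[OF measurable_coordinate(1)[OF pol] Z'(1)])
    have "emeasure (traj \<pi>) {\<omega> \<in> space (traj \<pi>). \<omega> t \<in> Z} = (\<integral>\<^sup>+\<omega>. indicator Z (\<omega> t) \<partial>traj \<pi>)"
      unfolding nn_integral_indicator[OF m, symmetric] by (rule nn_integral_cong) (auto simp: indicator_def)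
    also have "\<dots> = emeasure (law \<kappa> t) Z"
      using Z'(1) s by (simp add: nn_integral_traj_coordinate[OF pol \<kappa> fol i])
    also have "\<dots> = emeasure (restrict_space (law \<kappa> t) live_pairs) Z"
      by (rule emeasure_restrict_law[OF \<kappa> Z'(2), symmetric])
    finally show ?thesis .
  qed
  then show "emeasure (occupancy \<pi>) Z = (\<Sum>t. emeasure (restrict_space (law \<kappa> t) live_pairs) Z)"
    by (simp add: emeasure_occupancy[OF pol Z])
qed

text \<open>
  Both occupancy measures are the sum of the same laws, which depend on the kernel alone.
\<close>

lemma occupancy_cong:
  assumes "policy \<pi>" "policy \<pi>'" "admissible_kernel \<kappa>" "follows \<pi> \<kappa>" "follows \<pi>' \<kappa>"
  shows "occupancy \<pi> = occupancy \<pi>'"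
  using occupancy_countable_sum[of \<pi> \<kappa>] occupancy_countable_sum[of \<pi>' \<kappa>] assms
  by (intro measure_eqI) (auto simp: is_countable_sum_def)

lemma deterministic_policyD:
  assumes "\<pi> \<in> deterministic_policies"
  shows "policy \<pi>" and "\<pi> \<in> nonrandomized_markov_policies"
  using assms
  by (auto simp: deterministic_policies_def nonrandomized_markov_policies_def stationary_def markov_def)

text \<open>
  The only available action at \<open>xbar\<close> leaves no choice.  Hence switching between kernels never
  changes anything at \<open>xbar\<close>, the one state that may carry positive mass.
\<close>

lemma admissible_kernel_xbar:
  assumes "admissible_kernel \<kappa>" "admissible_kernel \<kappa>'"
  shows "\<kappa> xbar = \<kappa>' xbar"
proof -
  obtain abar where a: "Act xbar = {abar}" using absorbing_xbar by blast
  have "emeasure (\<kappa> xbar) {abar} = 1" "emeasure (\<kappa>' xbar) {abar} = 1"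
    using assms a xbar_space by (auto simp: admissible_kernel_def)
  then show ?thesis
    using admissible_kernelD(2,3)[OF assms(1) xbar_space] admissible_kernelD(2,3)[OF assms(2) xbar_space]
    by (intro prob_space_eqI_point[of _ abar]) auto
qed

end

section \<open>Uniformly small tails\<close>

context uniformly_absorbing_mdp
begin

lemma uniform_law_tail:
  assumes "0 < c"
  obtains n where "\<And>\<kappa>. deterministic_kernel \<kappa> \<Longrightarrow>
    (\<Sum>t. emeasure (law \<kappa> (n + t)) live_pairs) \<le> ennreal c"
proof -
  let ?T = "\<lambda>n \<pi>. \<integral>\<^sup>+\<omega>. (\<Sum>t. if enat (n + t) < hitting_time xbar \<omega> then 1 else 0 :: ennreal) \<partial>traj \<pi>"
  have "eventually (\<lambda>n. (SUP \<pi>\<in>nonrandomized_markov_policies. ?T n \<pi>) < ennreal c) sequentially"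
    by (rule order_tendstoD(2)[OF uniformly_absorbing]) (use assms in simp)
  then obtain n where n: "(SUP \<pi>\<in>nonrandomized_markov_policies. ?T n \<pi>) < ennreal c"
    by (auto simp: eventually_sequentially)
  show thesis
  proof
    fix \<kappa> assume \<kappa>: "deterministic_kernel \<kappa>"
    then have a: "admissible_kernel \<kappa>" by (simp add: deterministic_kernel_def)
    note pol = deterministic_policyD[OF stationary_policy_deterministic[OF \<kappa>]]
    have "(\<Sum>t. emeasure (law \<kappa> (n + t)) live_pairs) \<le> ?T n (stationary_policy \<kappa>)"
      by (rule sum_law_tail_le[OF pol(1) a follows_stationary_policy])
    also have "\<dots> \<le> (SUP \<pi>\<in>nonrandomized_markov_policies. ?T n \<pi>)"
      by (rule SUP_upper[OF pol(2)])
    also note n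
    finally show "(\<Sum>t. emeasure (law \<kappa> (n + t)) live_pairs) \<le> ennreal c" by simp
  qed
qed

end

section \<open>State laws without atoms\<close>

context atomless_mdp
begin

text \<open>
  An atom at \<open>y \<noteq> xbar\<close> cannot be created by a transition from a state other than \<open>xbar\<close>, by
  atomlessness, nor by one from \<open>xbar\<close>, which is never left.
\<close>

lemma state_law_atomless:
  assumes \<kappa>: "admissible_kernel \<kappa>" and y: "y \<in> space SX - {xbar}"
  shows "emeasure (state_law \<kappa> t) {y} = 0"
proof (cases t)
  case 0
  then show ?thesis using atomless_initial[OF y] by simp
next
  case (Suc n)
  have Y: "{y} \<in> sets SX" using y singleton_sets by simp
  have m: "(\<lambda>z. emeasure (p z) {y}) \<in> borel_measurable (SX \<Otimes>\<^sub>M SA)"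
    by (rule measurable_compose[OF measurable_prob_algebraD[OF transition]
          measurable_emeasure_subprob_algebra[OF Y]])
  have "emeasure (p (x, a)) {y} = 0" if x: "x \<in> space SX" and a: "a \<in> Act x" for x a
  proof (cases "x = xbar")
    case True
    have "sets (p (x, a)) = sets SX" using transition_prob[OF x a] by (simp add: space_prob_algebra)
    then have "emeasure (p (x, a)) {y} \<le> emeasure (p (x, a)) (space SX - {xbar})"
      using y singleton_sets[OF xbar_space] by (intro emeasure_mono) auto
    then show ?thesis using no_escape a True by simp
  next
    case False
    then show ?thesis using atomless_transition[OF _ y a] x by simp
  qed
  then have "(\<integral>\<^sup>+z. emeasure (p z) {y} \<partial>law \<kappa> n) = 0"
    by (intro nn_integral_law_eq_0[OF \<kappa> m])
  then show ?thesis
    unfolding Suc state_law_Suc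
    by (simp add: emeasure_bind_prob_algebra[OF law_prob[OF \<kappa>] transition Y])
qed

text \<open>
  The windows decrease to the level set \<open>{g = s}\<close> without \<open>xbar\<close>, which by injectivity of
  \<open>g\<close> has at most one point and is therefore null.
\<close>

lemma state_law_level_window:
  fixes g :: "'x \<Rightarrow> real"
  assumes \<kappa>: "admissible_kernel \<kappa>" and g: "g \<in> borel_measurable SX" "inj_on g (space SX)"
  shows "(\<lambda>k. measure (state_law \<kappa> t) {x \<in> space SX - {xbar}. \<bar>g x - s\<bar> \<le> 1 / real (Suc k)}) \<longlonglongrightarrow> 0"
proof -
  let ?E = "\<lambda>k. {x \<in> space SX - {xbar}. \<bar>g x - s\<bar> \<le> 1 / real (Suc k)}"
  have s: "sets (state_law \<kappa> t) = sets SX" and "prob_space (state_law \<kappa> t)"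
    using state_law_prob[OF \<kappa>] by (auto simp: space_prob_algebra)
  then interpret prob_space "state_law \<kappa> t" by simp
  have [measurable]: "space SX - {xbar} \<in> sets SX"
    using singleton_sets[OF xbar_space] by auto
  note [measurable] = g(1)
  have "?E k = {x \<in> space SX. x \<in> space SX - {xbar} \<and> \<bar>g x - s\<bar> \<le> 1 / real (Suc k)}" for k by auto
  also have "\<dots> k \<in> sets SX" for k by measurable
  finally have "range ?E \<subseteq> events" using s by auto
  moreover have "decseq ?E"
    by (rule decseq_SucI) (auto intro: order_trans simp: frac_le)
  ultimately have "(\<lambda>k. measure (state_law \<kappa> t) (?E k)) \<longlonglongrightarrow> measure (state_law \<kappa> t) (\<Inter>k. ?E k)"
    by (rule finite_Lim_measure_decseq)
  also have "measure (state_law \<kappa> t) (\<Inter>k. ?E k) = 0"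
  proof (cases "(\<Inter>k. ?E k) = {}")
    case False
    then obtain y where y: "y \<in> (\<Inter>k. ?E k)" by blast
    then have y0: "y \<in> space SX - {xbar}" by blast
    have lev: "g x = s" if "x \<in> (\<Inter>k. ?E k)" for x
    proof (rule ccontr)
      assume "g x \<noteq> s"
      then obtain k where "1 / real (Suc k) < \<bar>g x - s\<bar>"
        using reals_Archimedean[of "\<bar>g x - s\<bar>"] by (auto simp: field_simps)
      then show False using that by (auto dest: spec[of _ k])
    qed
    have "x = y" if "x \<in> (\<Inter>k. ?E k)" for x
      by (rule inj_onD[OF g(2)]) (use lev[OF that] lev[OF y] that y in auto)
    with y have "(\<Inter>k. ?E k) = {y}" by blast
    then show ?thesis
      using state_law_atomless[OF \<kappa> y0, of t] by (simp add: measure_def)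
  qed simp
  finally show ?thesis .
qed

end

section \<open>The switching path\<close>

locale uniformly_absorbing_atomless_mdp =
  uniformly_absorbing_mdp SX SA Act p mu r xbar + atomless_mdp SX SA Act p mu r xbar
  for SX :: "'x measure" and SA :: "'a measure" and Act p mu
    and r :: "'x \<times> 'a \<Rightarrow> real ^ 'n" and xbar
begin

lemma occupancy_finite:
  assumes "\<pi> \<in> deterministic_policies"
  shows "occupancy \<pi> \<in> finite_measures (live \<Otimes>\<^sub>M SA)"
proof -
  obtain \<kappa> where \<kappa>: "deterministic_kernel \<kappa>" "follows \<pi> \<kappa>"
    using deterministic_policy_kernel[OF assms] .
  then have a: "admissible_kernel \<kappa>" by (simp add: deterministic_kernel_def)
  obtain n where n: "\<And>\<kappa>. deterministic_kernel \<kappa> \<Longrightarrow>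
    (\<Sum>t. emeasure (law \<kappa> (n + t)) live_pairs) \<le> ennreal 1"
    using uniform_law_tail[of 1] by auto
  show ?thesis
  proof (rule finite_countable_sum[OF occupancy_countable_sum[OF _ a \<kappa>(2)]])
    show "policy \<pi>" by (rule deterministic_policyD[OF assms])
    show "(\<Sum>t. emeasure (restrict_space (law \<kappa> (n + t)) live_pairs) (space (live \<Otimes>\<^sub>M SA))) \<le> ennreal 1"
      using n[OF \<kappa>(1)] by (simp add: emeasure_restrict_law[OF a] live_pairs(3))
  qed
qed

definition switch :: "('x \<Rightarrow> real) \<Rightarrow> ('x \<Rightarrow> 'a measure) \<Rightarrow> ('x \<Rightarrow> 'a measure) \<Rightarrow> real \<Rightarrow> 'x \<Rightarrow> 'a measure" where
  "switch g \<kappa>\<^sub>0 \<kappa>\<^sub>1 s x = (if g x \<le> s then \<kappa>\<^sub>1 x else \<kappa>\<^sub>0 x)"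

lemma deterministic_kernel_switch:
  assumes g: "g \<in> borel_measurable SX" and "deterministic_kernel \<kappa>\<^sub>0" "deterministic_kernel \<kappa>\<^sub>1"
  shows "deterministic_kernel (switch g \<kappa>\<^sub>0 \<kappa>\<^sub>1 s)"
proof -
  note [measurable] = g
  have [measurable]: "\<kappa>\<^sub>0 \<in> SX \<rightarrow>\<^sub>M prob_algebra SA" "\<kappa>\<^sub>1 \<in> SX \<rightarrow>\<^sub>M prob_algebra SA"
    using assms by (auto simp: deterministic_kernel_def admissible_kernel_def)
  have "switch g \<kappa>\<^sub>0 \<kappa>\<^sub>1 s \<in> SX \<rightarrow>\<^sub>M prob_algebra SA"
    unfolding switch_def by measurable
  then show ?thesis
    using assms by (auto simp: deterministic_kernel_def admissible_kernel_def switch_def)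
qed

text \<open>
  Continuity of the path.  The horizon \<open>n\<close> is chosen first, from the uniform tail bound; this
  bound holds for both parameters, so the window around \<open>s\<close> can be chosen afterwards, using
  only the state laws at the fixed parameter \<open>s\<close>.
\<close>

lemma tv_dist_switch_small:
  assumes g: "g \<in> borel_measurable SX" "inj_on g (space SX)"
    and \<kappa>: "deterministic_kernel \<kappa>\<^sub>0" "deterministic_kernel \<kappa>\<^sub>1" and \<epsilon>: "0 < \<epsilon>"
  obtains \<delta> where "0 < \<delta>" "\<And>s'. \<bar>s' - s\<bar> \<le> \<delta> \<Longrightarrow>
    tv_dist (live \<Otimes>\<^sub>M SA) (occupancy (stationary_policy (switch g \<kappa>\<^sub>0 \<kappa>\<^sub>1 s)))
      (occupancy (stationary_policy (switch g \<kappa>\<^sub>0 \<kappa>\<^sub>1 s'))) < \<epsilon>"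
proof -
  let ?N = "SX \<Otimes>\<^sub>M SA" and ?L = "live \<Otimes>\<^sub>M SA" and ?k = "switch g \<kappa>\<^sub>0 \<kappa>\<^sub>1"
  let ?E = "\<lambda>k. {x \<in> space SX - {xbar}. \<bar>g x - s\<bar> \<le> 1 / real (Suc k)}"
  have det: "deterministic_kernel (?k u)" for u
    by (rule deterministic_kernel_switch[OF g(1) \<kappa>])
  then have adm: "admissible_kernel (?k u)" for u by (simp add: deterministic_kernel_def)
  have adm01: "admissible_kernel \<kappa>\<^sub>0" "admissible_kernel \<kappa>\<^sub>1"
    using \<kappa> by (auto simp: deterministic_kernel_def)
  obtain n where tail: "\<And>\<kappa>. deterministic_kernel \<kappa> \<Longrightarrow>
    (\<Sum>t. emeasure (law \<kappa> (n + t)) live_pairs) \<le> ennreal (\<epsilon> / 4)"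
    using uniform_law_tail[of "\<epsilon> / 4"] \<epsilon> by auto
  have "(\<lambda>k. \<Sum>t<n. 2 * (\<Sum>i\<le>t. measure (state_law (?k s) i) (?E k)))
      \<longlonglongrightarrow> (\<Sum>t<n. 2 * (\<Sum>i\<le>t. 0))"
    by (intro tendsto_intros state_law_level_window adm g)
  then have "eventually (\<lambda>k. (\<Sum>t<n. 2 * (\<Sum>i\<le>t. measure (state_law (?k s) i) (?E k))) < \<epsilon> / 4) sequentially"
    by (rule order_tendstoD(2)) (use \<epsilon> in simp)
  then obtain k where k: "(\<Sum>t<n. 2 * (\<Sum>i\<le>t. measure (state_law (?k s) i) (?E k))) < \<epsilon> / 4"
    by (auto simp: eventually_sequentially)
  have E: "?E k \<in> sets SX"
  proof -
    note [measurable] = g(1)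
    have "{x \<in> space SX. \<bar>g x - s\<bar> \<le> 1 / real (Suc k)} - {xbar} \<in> sets SX"
      using singleton_sets[OF xbar_space] by (intro sets.Diff) measurable
    moreover have "{x \<in> space SX. \<bar>g x - s\<bar> \<le> 1 / real (Suc k)} - {xbar} = ?E k" by auto
    ultimately show ?thesis by simp
  qed
  show thesis
  proof
    show "0 < 1 / real (Suc k)" by simp
    fix s' assume s': "\<bar>s' - s\<bar> \<le> 1 / real (Suc k)"
    have eq: "?k s x = ?k s' x" if "x \<in> space SX - ?E k" for x
    proof (cases "x = xbar")
      case True
      then show ?thesis using admissible_kernel_xbar[OF adm01] by (simp add: switch_def)
    next
      case False
      then have "1 / real (Suc k) < \<bar>g x - s\<bar>" using that by auto
      then show ?thesis using s' by (auto simp: switch_def)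
    qed
    let ?R = "\<lambda>u t. restrict_space (law (?k u) t) live_pairs"
    have Q: "is_countable_sum ?L (?R u) (occupancy (stationary_policy (?k u)))" for u
      by (intro occupancy_countable_sum adm follows_stationary_policy
          deterministic_policyD stationary_policy_deterministic det)
    have T: "(\<Sum>t. emeasure (?R u (n + t)) (space ?L)) \<le> ennreal (\<epsilon> / 4)" for u
      using tail[OF det] by (simp add: emeasure_restrict_law[OF adm] live_pairs(3))
    have "tv_dist ?L (?R s t) (?R s' t) \<le> 2 * (\<Sum>i\<le>t. measure (state_law (?k s) i) (?E k))" for t
    proof -
      \<comment> \<open>The distance depends on its first argument only through the \<open>\<sigma>\<close>-algebra.\<close>
      have "tv_dist ?L (?R s t) (?R s' t) = tv_dist (restrict_space ?N live_pairs) (?R s t) (?R s' t)"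
        using live_pairs(2) sets_eq_imp_space_eq[OF live_pairs(2)]
        by (simp add: tv_dist_def finite_measures_def tv_test_functions_def measurable_cong_sets[OF live_pairs(2) refl])
      also have "\<dots> \<le> tv_dist ?N (law (?k s) t) (law (?k s') t)"
        by (intro tv_dist_restrict_space_le prob_algebra_finite_measures law_prob adm live_pairs(1))
      also have "\<dots> \<le> 2 * (\<Sum>i\<le>t. measure (state_law (?k s) i) (?E k))"
        by (rule tv_dist_law_le[OF adm adm E eq])
      finally show ?thesis .
    qed
    then have "(\<Sum>t<n. tv_dist ?L (?R s t) (?R s' t)) < \<epsilon> / 4"
      by (intro le_less_trans[OF sum_mono k])
    moreover have "tv_dist ?L (occupancy (stationary_policy (?k s))) (occupancy (stationary_policy (?k s')))
        \<le> 2 * ((\<Sum>t<n. tv_dist ?L (?R s t) (?R s' t)) + \<epsilon> / 4)"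
      by (rule tv_dist_countable_sum_le[OF Q Q _ T T]) (use \<epsilon> in simp)
    ultimately show "tv_dist ?L (occupancy (stationary_policy (?k s)))
        (occupancy (stationary_policy (?k s'))) < \<epsilon>"
      by simp
  qed
qed

theorem path_connectedin_det_occupancies:
  "path_connectedin (tv_topology (live \<Otimes>\<^sub>M SA)) det_occupancies"
  unfolding path_connectedin
proof (intro conjI ballI)
  let ?L = "live \<Otimes>\<^sub>M SA"
  show "det_occupancies \<subseteq> topspace (tv_topology ?L)"
    using occupancy_finite by (auto simp: topspace_tv_topology det_occupancies_def)
  fix Q\<^sub>0 Q\<^sub>1 assume "Q\<^sub>0 \<in> det_occupancies" "Q\<^sub>1 \<in> det_occupancies"
  then obtain \<pi>\<^sub>0 \<pi>\<^sub>1 where \<pi>: "\<pi>\<^sub>0 \<in> deterministic_policies" "\<pi>\<^sub>1 \<in> deterministic_policies"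
    and Q: "Q\<^sub>0 = occupancy \<pi>\<^sub>0" "Q\<^sub>1 = occupancy \<pi>\<^sub>1"
    by (auto simp: det_occupancies_def)
  obtain \<kappa>\<^sub>0 where \<kappa>\<^sub>0: "deterministic_kernel \<kappa>\<^sub>0" "follows \<pi>\<^sub>0 \<kappa>\<^sub>0"
    using deterministic_policy_kernel[OF \<pi>(1)] .
  obtain \<kappa>\<^sub>1 where \<kappa>\<^sub>1: "deterministic_kernel \<kappa>\<^sub>1" "follows \<pi>\<^sub>1 \<kappa>\<^sub>1"
    using deterministic_policy_kernel[OF \<pi>(2)] .
  obtain g :: "'x \<Rightarrow> real" where g: "g \<in> borel_measurable SX" "inj_on g (space SX)"
    and g01: "\<And>x. x \<in> space SX \<Longrightarrow> 0 < g x \<and> g x < 1"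
    using standard_borel_real_injection[OF standard_borel_SX] by metis
  define \<gamma> where "\<gamma> s = occupancy (stationary_policy (switch g \<kappa>\<^sub>0 \<kappa>\<^sub>1 s))" for s
  have det: "stationary_policy (switch g \<kappa>\<^sub>0 \<kappa>\<^sub>1 s) \<in> deterministic_policies" for s
    by (intro stationary_policy_deterministic deterministic_kernel_switch g \<kappa>\<^sub>0 \<kappa>\<^sub>1)
  interpret TV: Metric_space "finite_measures ?L" "tv_dist ?L"
    by (rule Metric_space_tv_dist)
  have "pathin (tv_topology ?L) \<gamma>"
    unfolding pathin_def tv_topology_def TV.continuous_map_to_metric
  proof (intro ballI allI impI)
    fix s \<epsilon> :: real assume "s \<in> topspace (subtopology euclideanreal {0..1})" "0 < \<epsilon>"
    then have s: "s \<in> {0..1}" by simp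
    obtain \<delta> where \<delta>: "0 < \<delta>" "\<And>s'. \<bar>s' - s\<bar> \<le> \<delta> \<Longrightarrow> tv_dist ?L (\<gamma> s) (\<gamma> s') < \<epsilon>"
      unfolding \<gamma>_def using tv_dist_switch_small[OF g \<kappa>\<^sub>0(1) \<kappa>\<^sub>1(1) \<open>0 < \<epsilon>\<close>, of s] by metis
    show "\<exists>U. openin (subtopology euclideanreal {0..1}) U \<and> s \<in> U \<and> (\<forall>y\<in>U. \<gamma> y \<in> TV.mball (\<gamma> s) \<epsilon>)"
    proof (intro exI[of _ "{0..1} \<inter> ball s \<delta>"] conjI ballI)
      show "openin (subtopology euclideanreal {0..1}) ({0..1} \<inter> ball s \<delta>)"
        by (rule openin_open_Int) simp
      show "s \<in> {0..1} \<inter> ball s \<delta>" using s \<delta>(1) by simp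
      fix y assume "y \<in> {0..1} \<inter> ball s \<delta>"
      then have "\<bar>y - s\<bar> \<le> \<delta>" by (auto simp: dist_real_def)
      then show "\<gamma> y \<in> TV.mball (\<gamma> s) \<epsilon>"
        using \<delta>(2) occupancy_finite[OF det] by (simp add: \<gamma>_def)
    qed
  qed
  moreover have "\<gamma> \<in> {0..1} \<rightarrow> det_occupancies"
    using det by (auto simp: \<gamma>_def det_occupancies_def)
  moreover have "\<gamma> 0 = Q\<^sub>0"
  proof -
    have "follows (stationary_policy (switch g \<kappa>\<^sub>0 \<kappa>\<^sub>1 0)) \<kappa>\<^sub>0"
      using g01 by (fastforce simp: follows_def stationary_policy_def switch_def space_history)
    then show ?thesis
      unfolding \<gamma>_def Q using \<kappa>\<^sub>0
      by (intro occupancy_cong deterministic_policyD det \<pi>) (auto simp: deterministic_kernel_def)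
  qed
  moreover have "\<gamma> 1 = Q\<^sub>1"
  proof -
    have "follows (stationary_policy (switch g \<kappa>\<^sub>0 \<kappa>\<^sub>1 1)) \<kappa>\<^sub>1"
      using g01 by (fastforce simp: follows_def stationary_policy_def switch_def space_history)
    then show ?thesis
      unfolding \<gamma>_def Q using \<kappa>\<^sub>1
      by (intro occupancy_cong deterministic_policyD det \<pi>) (auto simp: deterministic_kernel_def)
  qed
  ultimately show "\<exists>\<gamma>. pathin (tv_topology ?L) \<gamma> \<and> \<gamma> \<in> {0..1} \<rightarrow> det_occupancies \<and> \<gamma> 0 = Q\<^sub>0 \<and> \<gamma> 1 = Q\<^sub>1"
    by blast
qed

end

theorem theorem8p3:
  fixes SX :: "'x measure" and SA :: "'a measure"
    and Act :: "'x \<Rightarrow> 'a set"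
    and p :: "'x \<times> 'a \<Rightarrow> 'x measure"
    and mu :: "'x measure"
    and r :: "'x \<times> 'a \<Rightarrow> real ^ 'n"
    and xbar :: 'x
  assumes "uniformly_absorbing_mdp SX SA Act p mu r xbar"
    and "atomless_mdp SX SA Act p mu r xbar"
  shows "path_connectedin (tv_topology (absorbing_mdp.live SX xbar \<Otimes>\<^sub>M SA))
           (absorbing_mdp.det_occupancies SX SA Act p mu xbar)
       \<and> path_connectedin (setwise_topology (absorbing_mdp.live SX xbar \<Otimes>\<^sub>M SA))
           (absorbing_mdp.det_occupancies SX SA Act p mu xbar)"
proof -
  interpret uniformly_absorbing_atomless_mdp SX SA Act p mu r xbar
    using assms by (rule uniformly_absorbing_atomless_mdp.intro)
  show ?thesis
    using path_connectedin_det_occupancies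
      path_connectedin_continuous_map_image[OF continuous_map_tv_setwise path_connectedin_det_occupancies]
    by simp
qed

end
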